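(* Let $K$ be an algebraically closed field of characteristic $\ne2$, $G=\mathrm{PGL}_n(K)$, $n=2^st$ with $t$ odd and $s,t\ge1$. Let $1\le r\le s$, $n=2^rk$, and let $D=D_r\times (H\otimes I_{2^r})$, where $H$ is either trivial or a toral elementary abelian $2$-subgroup of $\mathrm{PGL}_k(K)$ with $C_{\mathrm{PGL}_k(K)}(H)$ connected. Then $C_G(D)=\langle C_G(D)^\circ,\bar B_0,\dots,\bar B_{r-1}\rangle=C_G(D)^\circ\cdot B_r$.
   Context: $C_G(D)^\circ$ is the identity component. Notation ($p=2$): for $0\le s'\le r-1$, $\sigma_{s'}$ is the permutation of $\{1,\dots,2^r\}$ with $\sigma_{s'}(i)=i+2^{s'}$ if $i\equiv 1,\dots,2^{s'}\pmod{2^{s'+1}}$ and $\sigma_{s'}(i)=i-2^{s'}$ otherwise; $A_{s'}$ is diagonal $2^r\times2^r$ with $(A_{s'})_{ii}=(-1)^{\lfloor(i-1)/2^{s'}\rfloor}$; $B_{s'}$ is the permutation matrix with $(B_{s'})_{ij}=1$ iff $\sigma_{s'}(i)=j$. $\bar A_{s'},\bar B_{s'}\in\mathrm{PGL}_n(K)$ are the images of $I_k\otimes A_{s'}$, $I_k\otimes B_{s'}$. $D_r=\langle\bar A_0,\dots,\bar A_{r-1}\rangle$, $B_r=\langle\bar B_0,\dots,\bar B_{r-1}\rangle$. $H\otimes I_{2^r}$ is the image of $\{h\otimes I_{2^r}:h\in H\}$ (Kronecker product). Toral means contained in a maximal torus. *)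

theory Defs
  imports "HOL-Analysis.Analysis" "HOL-Algebra.Generated_Groups" "HOL-Algebra.Coset"
    "Jordan_Normal_Form.Determinant" "HOL-Computational_Algebra.Polynomial"
begin

definition alg_closed_field :: "'a::field itself \<Rightarrow> bool" where
  "alg_closed_field _ \<longleftrightarrow> (\<forall>p::'a poly. degree p > 0 \<longrightarrow> (\<exists>x. poly p x = 0))"

definition GLn :: "nat \<Rightarrow> 'a::field mat set" where
  "GLn n = {A \<in> carrier_mat n n. det A \<noteq> 0}"

definition pcl :: "'a::field mat \<Rightarrow> 'a mat set" where
  "pcl A = {c \<cdot>\<^sub>m A | c. c \<noteq> 0}"

definition PGL :: "nat \<Rightarrow> ('a::field mat set) monoid" where
  "PGL n = \<lparr> carrier = pcl ` GLn n,
             mult = (\<lambda>X Y. pcl ((SOME A. A \<in> X) * (SOME B. B \<in> Y))),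
             one = pcl (1\<^sub>m n) \<rparr>"

inductive_set polyfun :: "nat \<Rightarrow> ('a::field mat \<Rightarrow> 'a) set" for n where
  pf_const: "(\<lambda>A. c) \<in> polyfun n"
| pf_entry: "i < n \<Longrightarrow> j < n \<Longrightarrow> (\<lambda>A. A $$ (i, j)) \<in> polyfun n"
| pf_add: "f \<in> polyfun n \<Longrightarrow> g \<in> polyfun n \<Longrightarrow> (\<lambda>A. f A + g A) \<in> polyfun n"
| pf_mult: "f \<in> polyfun n \<Longrightarrow> g \<in> polyfun n \<Longrightarrow> (\<lambda>A. f A * g A) \<in> polyfun n"

text \<open>Zariski closed subsets of GL_n (the principal open set det \<noteq> 0 of affine n^2-space).\<close>
definition GL_closed :: "nat \<Rightarrow> 'a::field mat set \<Rightarrow> bool" where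
  "GL_closed n S \<longleftrightarrow> S \<subseteq> GLn n \<and>
     (\<exists>F \<subseteq> polyfun n. S = {A \<in> GLn n. \<forall>f\<in>F. f A = 0})"

text \<open>Zariski topology of PGL_n: quotient topology of GL_n -> PGL_n.\<close>
definition pgl_top :: "nat \<Rightarrow> 'a::field mat set topology" where
  "pgl_top n = topology (\<lambda>U. U \<subseteq> carrier (PGL n) \<and>
       GL_closed n (\<Union> (carrier (PGL n) - U)))"

definition identity_component :: "nat \<Rightarrow> 'a::field mat set set \<Rightarrow> 'a mat set set" where
  "identity_component n C = connected_component_of_set (subtopology (pgl_top n) C) (one (PGL n))"

definition centralizer :: "('g, 'b) monoid_scheme \<Rightarrow> 'g set \<Rightarrow> 'g set" where
  "centralizer G S = {g \<in> carrier G. \<forall>s\<in>S. g \<otimes>\<^bsub>G\<^esub> s = s \<otimes>\<^bsub>G\<^esub> g}"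

definition elem_abelian_2_subgroup :: "('g, 'b) monoid_scheme \<Rightarrow> 'g set \<Rightarrow> bool" where
  "elem_abelian_2_subgroup G H \<longleftrightarrow> subgroup H G \<and>
     (\<forall>x\<in>H. \<forall>y\<in>H. x \<otimes>\<^bsub>G\<^esub> y = y \<otimes>\<^bsub>G\<^esub> x) \<and> (\<forall>x\<in>H. x \<otimes>\<^bsub>G\<^esub> x = \<one>\<^bsub>G\<^esub>)"

definition diag_torus :: "nat \<Rightarrow> 'a::field mat set set" where
  "diag_torus k = pcl ` {A \<in> GLn k. \<forall>i<k. \<forall>j<k. i \<noteq> j \<longrightarrow> A $$ (i, j) = 0}"

definition maximal_torus :: "nat \<Rightarrow> 'a::field mat set set \<Rightarrow> bool" where
  "maximal_torus k T \<longleftrightarrow> (\<exists>g \<in> carrier (PGL k).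
      T = (\<lambda>t. g \<otimes>\<^bsub>PGL k\<^esub> t \<otimes>\<^bsub>PGL k\<^esub> inv\<^bsub>PGL k\<^esub> g) ` diag_torus k)"

definition toral :: "nat \<Rightarrow> 'a::field mat set set \<Rightarrow> bool" where
  "toral k H \<longleftrightarrow> (\<exists>T. maximal_torus k T \<and> H \<subseteq> T)"

definition kron :: "'a::field mat \<Rightarrow> 'a mat \<Rightarrow> 'a mat" where
  "kron X Y = mat (dim_row X * dim_row Y) (dim_col X * dim_col Y)
     (\<lambda>(a, b). X $$ (a div dim_row Y, b div dim_col Y) * Y $$ (a mod dim_row Y, b mod dim_col Y))"

text \<open>sigma_s on {1..2^r} (1-based as in the paper).\<close>
definition sigma_perm :: "nat \<Rightarrow> nat \<Rightarrow> nat" where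
  "sigma_perm s i = (if i mod 2^(s+1) \<in> {1..2^s} then i + 2^s else i - 2^s)"

text \<open>Matrices of size 2^r; entry (i,j) of the paper is entry (i-1,j-1) here.\<close>
definition Amat :: "nat \<Rightarrow> nat \<Rightarrow> 'a::field mat" where
  "Amat r s = mat (2^r) (2^r) (\<lambda>(i, j). if i = j then (-1) ^ ((i + 1 - 1) div 2^s) else 0)"

definition Bmat :: "nat \<Rightarrow> nat \<Rightarrow> 'a::field mat" where
  "Bmat r s = mat (2^r) (2^r) (\<lambda>(i, j). if sigma_perm s (i + 1) = j + 1 then 1 else 0)"

definition Abar :: "nat \<Rightarrow> nat \<Rightarrow> nat \<Rightarrow> 'a::field mat set" where
  "Abar k r s = pcl (kron (1\<^sub>m k) (Amat r s))"

definition Bbar :: "nat \<Rightarrow> nat \<Rightarrow> nat \<Rightarrow> 'a::field mat set" where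
  "Bbar k r s = pcl (kron (1\<^sub>m k) (Bmat r s))"

definition Dgrp :: "nat \<Rightarrow> nat \<Rightarrow> 'a::field mat set set" where
  "Dgrp k r = generate (PGL (2^r * k)) ((\<lambda>s. Abar k r s) ` {0..<r})"

definition Bgrp :: "nat \<Rightarrow> nat \<Rightarrow> 'a::field mat set set" where
  "Bgrp k r = generate (PGL (2^r * k)) ((\<lambda>s. Bbar k r s) ` {0..<r})"

definition tensor_id :: "nat \<Rightarrow> nat \<Rightarrow> 'a::field mat set set \<Rightarrow> 'a mat set set" where
  "tensor_id k r H = {pcl (kron h (1\<^sub>m (2^r))) | h. pcl h \<in> H \<and> h \<in> GLn k}"

end

theory Submission
  imports Defs
begin

text \<open>Conjugation multiplies each lift of \<open>A_s\<close> by a sign on the centralizer \<open>C\<close> of \<open>D\<close>, and \<open>B_s\<close>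
  changes exactly the sign of \<open>A_s\<close>. Hence every element of \<open>C\<close> is a product of an element of \<open>B_r\<close>
  and the class of a matrix \<open>Y\<close> that commutes with all lifts of the \<open>A_s\<close>, i.e. that is block
  diagonal along the residues modulo \<open>2^r\<close>. Up to a scalar \<open>c\<close>, \<open>Y\<close> commutes with a lift of an
  element \<open>h\<close> of \<open>H\<close>, and \<open>c\<close> can be read off from one block, whose class centralizes \<open>H\<close> in
  \<open>PGL_k\<close>. The commutator with \<open>h\<close> is a continuous sign on that connected centralizer, so \<open>c = 1\<close>.
  Thus \<open>Y\<close> commutes with all lifts of \<open>D\<close>, and so does every point of the line through \<open>1\<close> and \<open>Y\<close>;
  the invertible part of this line is irreducible, so the class of \<open>Y\<close> lies in the identity
  component of \<open>C\<close>.\<close>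

subsection \<open>Projective linear groups and their Zariski topology\<close>

lemma GLn_mult: "A \<in> GLn n \<Longrightarrow> B \<in> GLn n \<Longrightarrow> A * B \<in> GLn n"
  by (auto simp: GLn_def det_mult)

lemma GLn_one: "1\<^sub>m n \<in> GLn n"
  by (simp add: GLn_def)

lemma GLn_carrier: "A \<in> GLn n \<Longrightarrow> A \<in> carrier_mat n n"
  by (simp add: GLn_def)

lemma GLn_smult: "A \<in> GLn n \<Longrightarrow> c \<noteq> 0 \<Longrightarrow> c \<cdot>\<^sub>m A \<in> GLn n"
  by (auto simp: GLn_def)

lemma GLn_I:
  assumes "A \<in> carrier_mat n n" "B \<in> carrier_mat n n" "A * B = 1\<^sub>m n"
  shows "A \<in> GLn n"
proof -
  have "det A * det B = 1"
    using assms det_mult by (metis det_one)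
  then show ?thesis using assms by (auto simp: GLn_def)
qed

lemma GLn_inverse:
  assumes "A \<in> GLn n"
  obtains B where "B \<in> GLn n" "A * B = 1\<^sub>m n" "B * A = 1\<^sub>m n"
proof -
  have "A \<in> Units (ring_mat TYPE('a) n ())"
    using assms det_non_zero_imp_unit by (auto simp: GLn_def)
  then obtain B where "B \<in> carrier_mat n n" "A * B = 1\<^sub>m n" "B * A = 1\<^sub>m n"
    by (auto simp: Units_def ring_mat_def)
  then show thesis
    using that GLn_I[of B n A] GLn_carrier[OF assms] by blast
qed

lemma smult_smult_mat: "c \<cdot>\<^sub>m (d \<cdot>\<^sub>m (A :: 'a :: field mat)) = (c * d) \<cdot>\<^sub>m A"
  by (rule eq_matI) (auto simp: mult.assoc)

lemma one_smult_mat: "1 \<cdot>\<^sub>m (A :: 'a :: field mat) = A"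
  by (rule eq_matI) auto

lemma pcl_self: "A \<in> pcl A"
  unfolding pcl_def using one_smult_mat[of A] by (metis (mono_tags, lifting) mem_Collect_eq zero_neq_one)

lemma pcl_smult: "c \<noteq> 0 \<Longrightarrow> pcl (c \<cdot>\<^sub>m A) = pcl A"
proof (intro equalityI subsetI)
  fix B assume c: "c \<noteq> 0" and "B \<in> pcl A"
  then obtain d where "d \<noteq> 0" "B = d \<cdot>\<^sub>m A" by (auto simp: pcl_def)
  then have "B = (d / c) \<cdot>\<^sub>m (c \<cdot>\<^sub>m A)" "d / c \<noteq> 0" using c by (auto simp: smult_smult_mat)
  then show "B \<in> pcl (c \<cdot>\<^sub>m A)" by (auto simp: pcl_def)
qed (auto simp: pcl_def smult_smult_mat)

lemma pcl_eq_iff: "pcl A = pcl B \<longleftrightarrow> (\<exists>c. c \<noteq> 0 \<and> A = c \<cdot>\<^sub>m B)"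
proof
  assume "pcl A = pcl B"
  then have "A \<in> pcl B" using pcl_self by blast
  then show "\<exists>c. c \<noteq> 0 \<and> A = c \<cdot>\<^sub>m B" by (auto simp: pcl_def)
qed (auto simp: pcl_smult)

lemma pcl_mem_eq: "B \<in> pcl A \<Longrightarrow> pcl B = pcl A"
  unfolding pcl_eq_iff by (auto simp: pcl_def)

lemma carrier_PGL: "carrier (PGL n) = pcl ` GLn n"
  by (simp add: PGL_def)

lemma one_PGL: "\<one>\<^bsub>PGL n\<^esub> = pcl (1\<^sub>m n)"
  by (simp add: PGL_def)

lemma pcl_in_PGL: "A \<in> GLn n \<Longrightarrow> pcl A \<in> carrier (PGL n)"
  by (simp add: carrier_PGL)

text \<open>The product in \<open>PGL\<close> is defined through arbitrarily chosen representatives.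
  They differ from \<open>A\<close> and \<open>B\<close> by nonzero scalars, which move out of the
  matrix product and are absorbed by \<open>pcl\<close>.\<close>

lemma mult_PGL:
  assumes "A \<in> carrier_mat n n" "B \<in> carrier_mat n n"
  shows "pcl A \<otimes>\<^bsub>PGL n\<^esub> pcl B = pcl (A * B)"
proof -
  have "(SOME X. X \<in> pcl A) \<in> pcl A" "(SOME X. X \<in> pcl B) \<in> pcl B"
    using pcl_self by (metis someI_ex)+
  then obtain c d where cd: "c \<noteq> 0" "d \<noteq> 0"
      and eq: "(SOME X. X \<in> pcl A) = c \<cdot>\<^sub>m A" "(SOME X. X \<in> pcl B) = d \<cdot>\<^sub>m B"
    unfolding pcl_def by blast
  have "(c \<cdot>\<^sub>m A) * (d \<cdot>\<^sub>m B) = (d * c) \<cdot>\<^sub>m (A * B)"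
    using assms by (simp add: smult_smult_mat mult_smult_distrib[of _ n n _ n] mult_smult_assoc_mat[of _ n n _ n])
  then show ?thesis
    using cd by (simp add: PGL_def eq pcl_smult)
qed

lemma group_PGL: "group (PGL n)"
proof (rule groupI)
  fix x y z :: "'a mat set"
  assume "x \<in> carrier (PGL n)" "y \<in> carrier (PGL n)" "z \<in> carrier (PGL n)"
  then obtain A B C where *: "x = pcl A" "y = pcl B" "z = pcl C" "A \<in> GLn n" "B \<in> GLn n" "C \<in> GLn n"
    by (auto simp: carrier_PGL)
  note c = *(4-6)[THEN GLn_carrier]
  show "x \<otimes>\<^bsub>PGL n\<^esub> y \<otimes>\<^bsub>PGL n\<^esub> z = x \<otimes>\<^bsub>PGL n\<^esub> (y \<otimes>\<^bsub>PGL n\<^esub> z)"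
    using c assoc_mult_mat[OF c] by (simp add: * mult_PGL)
next
  fix x y :: "'a mat set"
  assume "x \<in> carrier (PGL n)" "y \<in> carrier (PGL n)"
  then show "x \<otimes>\<^bsub>PGL n\<^esub> y \<in> carrier (PGL n)"
    by (auto simp: carrier_PGL mult_PGL GLn_carrier GLn_mult)
next
  fix x :: "'a mat set"
  assume "x \<in> carrier (PGL n)"
  then obtain A where A: "x = pcl A" "A \<in> GLn n" by (auto simp: carrier_PGL)
  then show "\<one>\<^bsub>PGL n\<^esub> \<otimes>\<^bsub>PGL n\<^esub> x = x"
    by (simp add: one_PGL mult_PGL left_mult_one_mat[OF GLn_carrier] GLn_carrier)
  obtain B where "B \<in> GLn n" "B * A = 1\<^sub>m n" using GLn_inverse[OF A(2)] by blast
  then show "\<exists>y\<in>carrier (PGL n). y \<otimes>\<^bsub>PGL n\<^esub> x = \<one>\<^bsub>PGL n\<^esub>"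
    using A by (intro bexI[of _ "pcl B"]) (auto simp: mult_PGL GLn_carrier one_PGL carrier_PGL)
qed (simp add: one_PGL carrier_PGL GLn_one)

lemma pcl_commute_iff:
  assumes "A \<in> carrier_mat n n" "B \<in> carrier_mat n n"
  shows "pcl A \<otimes>\<^bsub>PGL n\<^esub> pcl B = pcl B \<otimes>\<^bsub>PGL n\<^esub> pcl A \<longleftrightarrow> (\<exists>c. c \<noteq> 0 \<and> A * B = c \<cdot>\<^sub>m (B * A))"
  using assms by (simp add: mult_PGL pcl_eq_iff)

section \<open>Zariski closed sets in the general linear group and the quotient topology\<close>

lemma polyfun_sum:
  "finite I \<Longrightarrow> (\<And>i. i \<in> I \<Longrightarrow> f i \<in> polyfun n) \<Longrightarrow> (\<lambda>A. \<Sum>i\<in>I. f i A) \<in> polyfun n"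
  by (induction I rule: finite_induct) (auto intro: polyfun.intros)

lemma GL_closedE:
  assumes "GL_closed n S"
  obtains F where "F \<subseteq> polyfun n" "S = {A \<in> GLn n. \<forall>f\<in>F. f A = 0}"
  using assms unfolding GL_closed_def by (elim conjE exE) (rule that)

lemma GL_closed_empty: "GL_closed n {}"
  unfolding GL_closed_def
  by (intro conjI exI[of _ "{\<lambda>A. 1}"]) (auto intro: pf_const)

text \<open>Multiply each equation of \<open>S\<close> with each equation of \<open>T\<close>: at a
  point outside both sets some \<open>f\<close> and some \<open>g\<close> are nonzero, hence so is
  their product.\<close>

lemma GL_closed_Un:
  assumes "GL_closed n S" "GL_closed n T"
  shows "GL_closed n (S \<union> T)"
proof -
  obtain F where F: "F \<subseteq> polyfun n" "S = {A \<in> GLn n. \<forall>f\<in>F. f A = 0}"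
    using assms(1) by (rule GL_closedE)
  obtain E where E: "E \<subseteq> polyfun n" "T = {A \<in> GLn n. \<forall>f\<in>E. f A = 0}"
    using assms(2) by (rule GL_closedE)
  let ?P = "{\<lambda>A. f A * g A | f g. f \<in> F \<and> g \<in> E}"
  have "?P \<subseteq> polyfun n" using F(1) E(1) by (auto intro: pf_mult)
  moreover have "S \<union> T = {A \<in> GLn n. \<forall>f\<in>?P. f A = 0}"
    (is "_ = ?R")
  proof (intro equalityI subsetI)
    fix A assume A: "A \<in> ?R"
    show "A \<in> S \<union> T"
    proof (rule ccontr)
      assume "A \<notin> S \<union> T"
      then obtain f g where "f \<in> F" "f A \<noteq> 0" "g \<in> E" "g A \<noteq> 0"
        using A F(2) E(2) by auto
      moreover from this have P: "(\<lambda>A. f A * g A) \<in> ?P" by (intro CollectI exI conjI) (rule refl)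
      have "\<forall>p\<in>?P. p A = 0" using A by simp
      from bspec[OF this P] have "f A * g A = 0" .
      ultimately show False by simp
    qed
  qed (auto simp: F(2) E(2))
  moreover have "S \<union> T \<subseteq> GLn n" using F(2) E(2) by auto
  ultimately show ?thesis unfolding GL_closed_def by blast
qed

text \<open>Collect the equations of all members. Intersecting with \<open>GLn n\<close> covers the
  empty family, whose plain intersection would be the whole type.\<close>

lemma GL_closed_INT:
  assumes "\<And>i. i \<in> I \<Longrightarrow> GL_closed n (S i)"
  shows "GL_closed n (GLn n \<inter> (\<Inter>i\<in>I. S i))"
proof -
  have "\<forall>i\<in>I. \<exists>F. F \<subseteq> polyfun n \<and> S i = {A \<in> GLn n. \<forall>f\<in>F. f A = 0}"
    using assms unfolding GL_closed_def by blast
  from bchoice[OF this] obtain F where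
    *: "\<forall>i\<in>I. F i \<subseteq> polyfun n \<and> S i = {A \<in> GLn n. \<forall>f\<in>F i. f A = 0}" ..
  have F: "F i \<subseteq> polyfun n" "S i = {A \<in> GLn n. \<forall>f\<in>F i. f A = 0}" if "i \<in> I" for i
    using bspec[OF * that] by simp_all
  have "GLn n \<inter> (\<Inter>i\<in>I. S i) = {A \<in> GLn n. \<forall>f\<in>(\<Union>i\<in>I. F i). f A = 0}"
    using F(2) by auto
  moreover have "(\<Union>i\<in>I. F i) \<subseteq> polyfun n" using F(1) by auto
  ultimately show ?thesis unfolding GL_closed_def by blast
qed

text \<open>Scalar classes partition \<open>GLn n\<close>, so the union of the classes outside
  \<open>U\<close> is the preimage of the complement of \<open>U\<close> under the quotient
  map.\<close>

lemma Union_PGL_diff: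
  assumes "U \<subseteq> carrier (PGL n)"
  shows "\<Union>(carrier (PGL n) - U) = {A \<in> GLn n. pcl A \<notin> U}"
proof (intro equalityI subsetI)
  fix A assume "A \<in> \<Union>(carrier (PGL n) - U)"
  then obtain B where "A \<in> pcl B" "B \<in> GLn n" "pcl B \<notin> U" by (auto simp: carrier_PGL)
  then show "A \<in> {A \<in> GLn n. pcl A \<notin> U}"
    using pcl_mem_eq[of A B] by (auto simp: pcl_def GLn_smult)
qed (use pcl_self in \<open>auto simp: carrier_PGL\<close>)

text \<open>\<open>topology\<close> returns the given predicate only if that predicate is a
  topology; the two closure properties needed come from unions and intersections of closed
  sets.\<close>

lemma openin_pgl_top:
  fixes U :: "'a::field mat set set"
  shows "openin (pgl_top n) U \<longleftrightarrow> U \<subseteq> carrier (PGL n) \<and> GL_closed n {A \<in> GLn n. pcl A \<notin> U}"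
proof -
  let ?L = "\<lambda>U :: 'a mat set set. U \<subseteq> carrier (PGL n) \<and> GL_closed n {A \<in> GLn n. pcl A \<notin> U}"
  have "?L (U \<inter> V)" if "?L U" "?L V" for U V
  proof -
    have "{A \<in> GLn n. pcl A \<notin> U \<inter> V} = {A \<in> GLn n. pcl A \<notin> U} \<union> {A \<in> GLn n. pcl A \<notin> V}"
      by auto
    with that GL_closed_Un[of n "{A \<in> GLn n. pcl A \<notin> U}" "{A \<in> GLn n. pcl A \<notin> V}"]
    show ?thesis by auto
  qed
  moreover have "?L (\<Union>\<K>)" if "\<forall>U\<in>\<K>. ?L U" for \<K>
  proof -
    have "{A \<in> GLn n. pcl A \<notin> \<Union>\<K>} = GLn n \<inter> (\<Inter>U\<in>\<K>. {A \<in> GLn n. pcl A \<notin> U})"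
      by auto
    with that GL_closed_INT[of \<K> n "\<lambda>U. {A \<in> GLn n. pcl A \<notin> U}"]
    show ?thesis by auto
  qed
  ultimately have "istopology ?L"
    unfolding istopology_def by (intro conjI allI impI) blast+
  moreover have "(\<lambda>U. U \<subseteq> carrier (PGL n) \<and> GL_closed n (\<Union>(carrier (PGL n) - U))) = ?L"
    by (rule ext, rule conj_cong) (simp_all add: Union_PGL_diff)
  ultimately show ?thesis by (simp add: pgl_top_def)
qed

lemma topspace_pgl_top: "topspace (pgl_top n) = carrier (PGL n)"
proof
  have "openin (pgl_top n) (carrier (PGL n) :: 'a mat set set)"
    unfolding openin_pgl_top using GL_closed_empty by (auto simp: carrier_PGL cong: conj_cong)
  then show "carrier (PGL n) \<subseteq> topspace (pgl_top n :: 'a mat set topology)"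
    by (rule openin_subset)
  show "topspace (pgl_top n) \<subseteq> (carrier (PGL n) :: 'a mat set set)"
    unfolding topspace_def using openin_pgl_top by blast
qed

text \<open>For fixed \<open>h\<close> and \<open>c\<close>, the entries of the difference of the
  two sides are linear forms in the entries of \<open>X\<close>.\<close>

lemma GL_closed_commute_up_to_scalar:
  assumes "h \<in> carrier_mat n n"
  shows "GL_closed n {X \<in> GLn n. X * h = c \<cdot>\<^sub>m (h * X)}"
proof -
  let ?f = "\<lambda>i j (A :: 'a mat). (\<Sum>l\<in>{..<n}. A $$ (i, l) * h $$ (l, j)) + (\<Sum>l\<in>{..<n}. (- c * h $$ (i, l)) * A $$ (l, j))"
  have ent: "(X * h = c \<cdot>\<^sub>m (h * X)) \<longleftrightarrow> (\<forall>i<n. \<forall>j<n. ?f i j X = 0)" if "X \<in> GLn n" for X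
  proof -
    have X: "X \<in> carrier_mat n n" using that by (rule GLn_carrier)
    have "?f i j X = (X * h) $$ (i, j) - (c \<cdot>\<^sub>m (h * X)) $$ (i, j)" if "i < n" "j < n" for i j
      using that X assms
      by (simp add: scalar_prod_def lessThan_atLeast0 sum_distrib_left sum_negf mult.assoc)
    moreover have "(X * h = c \<cdot>\<^sub>m (h * X)) \<longleftrightarrow> (\<forall>i<n. \<forall>j<n. (X * h) $$ (i, j) = (c \<cdot>\<^sub>m (h * X)) $$ (i, j))"
      using X assms by (auto simp: mat_eq_iff)
    ultimately show ?thesis by simp
  qed
  have "?f i j \<in> polyfun n" if "i < n" "j < n" for i j
    using that by (intro pf_add polyfun_sum pf_mult pf_entry pf_const) auto
  then have "{?f i j | i j. i < n \<and> j < n} \<subseteq> polyfun n" by blast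
  moreover have "{X \<in> GLn n. X * h = c \<cdot>\<^sub>m (h * X)} = {A \<in> GLn n. \<forall>f\<in>{?f i j | i j. i < n \<and> j < n}. f A = 0}"
  proof (rule Collect_cong, rule conj_cong)
    fix A :: "'a mat" assume "A \<in> GLn n"
    then show "(A * h = c \<cdot>\<^sub>m (h * A)) \<longleftrightarrow> (\<forall>f\<in>{?f i j | i j. i < n \<and> j < n}. f A = 0)"
      unfolding ent[OF \<open>A \<in> GLn n\<close>] by auto
  qed simp
  ultimately show ?thesis unfolding GL_closed_def by blast
qed

subsection \<open>Lines of matrices and Kronecker products\<close>

lemma polyfun_poly_curve:
  assumes "f \<in> polyfun n" and "\<And>i j. i < n \<Longrightarrow> j < n \<Longrightarrow> \<exists>p. \<forall>z. L z $$ (i, j) = poly p z"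
  shows "\<exists>p. \<forall>z. f (L z) = poly p z"
  using assms(1)
proof induction
  case (pf_const c)
  show ?case by (rule exI[of _ "[:c:]"]) simp
next
  case (pf_add f g)
  then show ?case by (metis poly_add)
next
  case (pf_mult f g)
  then show ?case by (metis poly_mult)
qed (rule assms(2))

text \<open>The affine line with the identity at \<open>z = 0\<close> and \<open>Y\<close> at
  \<open>z = 1\<close>. Commuting with a fixed matrix is a linear condition, so it holds along the
  whole line once it holds at \<open>Y\<close>.\<close>

definition mat_line :: "'a::field mat \<Rightarrow> 'a \<Rightarrow> 'a mat" where
  "mat_line Y z = 1\<^sub>m (dim_row Y) + z \<cdot>\<^sub>m (Y - 1\<^sub>m (dim_row Y))"

lemma mat_line_carrier: "Y \<in> carrier_mat n n \<Longrightarrow> mat_line Y z \<in> carrier_mat n n"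
  by (auto simp: mat_line_def)

lemma mat_line_0: "Y \<in> carrier_mat n n \<Longrightarrow> mat_line Y 0 = 1\<^sub>m n"
  by (rule eq_matI) (auto simp: mat_line_def)

lemma mat_line_1: "Y \<in> carrier_mat n n \<Longrightarrow> mat_line Y 1 = Y"
  by (rule eq_matI) (auto simp: mat_line_def)

lemma mat_line_entry:
  assumes "Y \<in> carrier_mat n n" "i < n" "j < n"
  shows "mat_line Y z $$ (i, j) = poly [:1\<^sub>m n $$ (i, j), Y $$ (i, j) - 1\<^sub>m n $$ (i, j):] z"
  using assms by (auto simp: mat_line_def)

lemma mat_line_commute:
  assumes "Y \<in> carrier_mat n n" "S \<in> carrier_mat n n" "Y * S = S * Y"
  shows "mat_line Y z * S = S * mat_line Y z"
proof -
  let ?E = "Y - 1\<^sub>m n"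
  have eq: "mat_line Y z = 1\<^sub>m n + z \<cdot>\<^sub>m ?E" and E: "?E \<in> carrier_mat n n"
    using assms(1) by (auto simp: mat_line_def)
  have "?E * S = Y * S - S" "S * ?E = S * Y - S"
    using assms(1,2) minus_mult_distrib_mat[of Y n n "1\<^sub>m n" S n]
      mult_minus_distrib_mat[of S n n Y n "1\<^sub>m n"] by auto
  moreover have "(1\<^sub>m n + z \<cdot>\<^sub>m ?E) * S = S + z \<cdot>\<^sub>m (?E * S)"
    using add_mult_distrib_mat[of "1\<^sub>m n" n n "z \<cdot>\<^sub>m ?E" S n] mult_smult_assoc_mat[OF E assms(2)] E assms(2)
    by auto
  moreover have "S * (1\<^sub>m n + z \<cdot>\<^sub>m ?E) = S + z \<cdot>\<^sub>m (S * ?E)"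
    using mult_add_distrib_mat[of S n n "1\<^sub>m n" n "z \<cdot>\<^sub>m ?E"] mult_smult_distrib[OF assms(2) E] E assms(2)
    by auto
  ultimately show ?thesis unfolding eq assms(3) by simp
qed

text \<open>Take the determinant of a matrix of linear polynomials; evaluation at \<open>z\<close>
  is a ring homomorphism and therefore commutes with \<open>det\<close>.\<close>

lemma det_mat_line:
  assumes "Y \<in> carrier_mat n n"
  shows "\<exists>p. \<forall>z. det (mat_line Y z) = poly p z"
proof -
  let ?M = "mat n n (\<lambda>(i, j). [:1\<^sub>m n $$ (i, j), Y $$ (i, j) - 1\<^sub>m n $$ (i, j):])"
  have "det (mat_line Y z) = poly (det ?M) z" for z
  proof -
    interpret ev: comm_ring_hom "\<lambda>p :: 'a poly. poly p z" by unfold_locales auto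
    have "map_mat (\<lambda>p. poly p z) ?M = mat_line Y z"
    proof (rule eq_matI)
      fix i j assume "i < dim_row (mat_line Y z)" "j < dim_col (mat_line Y z)"
      then show "map_mat (\<lambda>p. poly p z) ?M $$ (i, j) = mat_line Y z $$ (i, j)"
        using mat_line_carrier[OF assms, of z] mat_line_entry[OF assms, of i j z] by simp
    qed (use mat_line_carrier[OF assms, of z] in auto)
    then show ?thesis using ev.hom_det[of ?M] by simp
  qed
  then show ?thesis by blast
qed

text \<open>Over a finite field the product of all \<open>X - a\<close>, plus 1, is a nonconstant
  polynomial with value 1 everywhere.\<close>

lemma alg_closed_infinite:
  assumes "alg_closed_field TYPE('a::field)"
  shows "infinite (UNIV :: 'a set)"
proof
  assume fin: "finite (UNIV :: 'a set)"
  let ?p = "(\<Prod>a\<in>(UNIV :: 'a set). [:- a, 1:]) + 1"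
  have "degree (\<Prod>a\<in>(UNIV :: 'a set). [:- a, 1:]) = card (UNIV :: 'a set)"
    by (subst degree_prod_eq_sum_degree) auto
  moreover have "card (UNIV :: 'a set) > 0" using fin by (simp add: card_gt_0_iff)
  ultimately have "degree ?p > 0" by (simp add: degree_add_eq_left)
  then obtain x where "poly ?p x = 0" using assms unfolding alg_closed_field_def by blast
  moreover have "poly (\<Prod>a\<in>(UNIV :: 'a set). [:- a, 1:]) x = 0"
    using fin by (auto simp: poly_prod)
  ultimately show False by simp
qed

text \<open>A Zariski closed set either contains the whole line or meets it in finitely many points,
  and the field is infinite, so the invertible part of the line is irreducible.\<close>
lemma connectedin_pcl_mat_line:
  fixes Y :: "'a::field mat"
  assumes inf: "infinite (UNIV :: 'a set)" and Y: "Y \<in> carrier_mat n n"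
  shows "connectedin (pgl_top n) (pcl ` mat_line Y ` {z. det (mat_line Y z) \<noteq> 0})"
proof -
  define D where "D = {z. det (mat_line Y z) \<noteq> 0}"
  have GL: "mat_line Y z \<in> GLn n" if "z \<in> D" for z
    using that Y mat_line_carrier by (auto simp: D_def GLn_def)
  obtain d where d: "\<And>z. det (mat_line Y z) = poly d z" using det_mat_line[OF Y] by blast
  \<comment> \<open>The line passes through the identity at 0, where \<open>d\<close> has value 1.
    So only finitely many parameters give a singular matrix.\<close>
  have "d \<noteq> 0" using d[of 0] mat_line_0[OF Y] by auto
  then have "finite {z. poly d z = 0}" by (rule poly_roots_finite)
  moreover have "- D = {z. poly d z = 0}" by (auto simp: D_def d)
  ultimately have infD: "infinite D" using inf by (metis finite_compl)
  have dich: "D \<subseteq> Z" if "openin (pgl_top n) U" "Z = {z \<in> D. pcl (mat_line Y z) \<notin> U}" "infinite Z" for U Z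
  proof -
    have "GL_closed n {A \<in> GLn n. pcl A \<notin> U}" using that(1) by (simp add: openin_pgl_top)
    then obtain F where F: "F \<subseteq> polyfun n" "{A \<in> GLn n. pcl A \<notin> U} = {A \<in> GLn n. \<forall>f\<in>F. f A = 0}"
      by (rule GL_closedE)
    have Zeq: "z \<in> Z \<longleftrightarrow> (\<forall>f\<in>F. f (mat_line Y z) = 0)" if "z \<in> D" for z
    proof -
      have "mat_line Y z \<in> {A \<in> GLn n. pcl A \<notin> U} \<longleftrightarrow> (\<forall>f\<in>F. f (mat_line Y z) = 0)"
        unfolding F(2) using GL[OF that] by simp
      then show ?thesis using that GL[OF that] \<open>Z = _\<close> by simp
    qed
    have "f (mat_line Y z) = 0" if "f \<in> F" for f z
    proof -
      have "\<exists>p. \<forall>z. f (mat_line Y z) = poly p z"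
      proof (rule polyfun_poly_curve)
        show "f \<in> polyfun n" using that F(1) by (rule subsetD[rotated])
        show "\<exists>p. \<forall>z. mat_line Y z $$ (i, j) = poly p z" if "i < n" "j < n" for i j
          using mat_line_entry[OF Y that] by (intro exI allI)
      qed
      then obtain p where p: "\<And>z. f (mat_line Y z) = poly p z" by blast
      have "Z \<subseteq> {z. poly p z = 0}"
      proof
        fix z assume z: "z \<in> Z"
        then have "z \<in> D" using \<open>Z = _\<close> by simp
        then show "z \<in> {z. poly p z = 0}" using Zeq z that p by auto
      qed
      then have "infinite {z. poly p z = 0}" using \<open>infinite Z\<close> finite_subset by blast
      then have "p = 0" using poly_roots_finite by blast
      then show ?thesis using p by simp
    qed
    then show ?thesis using Zeq by blast
  qed
  let ?S = "pcl ` mat_line Y ` D"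
  show ?thesis unfolding connectedin D_def[symmetric]
  proof (intro conjI notI)
    show "?S \<subseteq> topspace (pgl_top n)"
      using GL by (auto simp: topspace_pgl_top carrier_PGL)
    assume "\<exists>U V. openin (pgl_top n) U \<and> openin (pgl_top n) V \<and> ?S \<subseteq> U \<union> V \<and>
      U \<inter> V \<inter> ?S = {} \<and> U \<inter> ?S \<noteq> {} \<and> V \<inter> ?S \<noteq> {}"
    then obtain U V where *: "openin (pgl_top n) U" "openin (pgl_top n) V" "U \<inter> V \<inter> ?S = {}"
      "U \<inter> ?S \<noteq> {}" "V \<inter> ?S \<noteq> {}"
      by (elim exE conjE) (rule that)
    let ?ZU = "{z \<in> D. pcl (mat_line Y z) \<notin> U}" and ?ZV = "{z \<in> D. pcl (mat_line Y z) \<notin> V}"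
    \<comment> \<open>\<open>U\<close> and \<open>V\<close> do not meet on the line, so every
      parameter avoids one of them. One of the two sets of avoiding parameters is infinite, hence is
      all of \<open>D\<close>, and the corresponding open set misses the line.\<close>
    have "D \<subseteq> ?ZU \<union> ?ZV" using *(3) by blast
    then have "infinite ?ZU \<or> infinite ?ZV" using infD finite_subset by blast
    then have "D \<subseteq> ?ZU \<or> D \<subseteq> ?ZV" using *(1,2) dich[of U ?ZU] dich[of V ?ZV] by blast
    then show False using *(4,5) by blast
  qed
qed

section \<open>Kronecker products, with indices split into quotient and remainder\<close>

lemma mult_mat_entry:
  assumes "A \<in> carrier_mat n m" "B \<in> carrier_mat m p" "i < n" "j < p"
  shows "(A * B) $$ (i, j) = (\<Sum>l<m. A $$ (i, l) * B $$ (l, j))"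
  using assms by (simp add: scalar_prod_def lessThan_atLeast0)

lemma kron_carrier:
  "X \<in> carrier_mat a b \<Longrightarrow> Y \<in> carrier_mat c d \<Longrightarrow> kron X Y \<in> carrier_mat (a * c) (b * d)"
  by (auto simp: kron_def)

lemma div_mod_less:
  assumes "i < m * (q :: nat)"
  shows "i div q < m" "i mod q < q"
proof -
  have "q > 0" using assms by (cases q) auto
  then show "i div q < m" "i mod q < q" using assms by (auto simp: div_less_iff_less_mult)
qed

lemma kron_entry:
  assumes "X \<in> carrier_mat a b" "Y \<in> carrier_mat c d" "i < a * c" "j < b * d"
  shows "kron X Y $$ (i, j) = X $$ (i div c, j div d) * Y $$ (i mod c, j mod d)"
  using assms by (auto simp: kron_def)

text \<open>Division with remainder is a bijection from the indices below \<open>m * q\<close> to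
  pairs; it turns the inner sum of a product of Kronecker products into a double sum.\<close>

lemma sum_div_mod:
  "(\<Sum>l<m * q. f (l div q) (l mod q)) = (\<Sum>x<m. \<Sum>y<(q :: nat). f x y)"
proof -
  have "(\<Sum>x<m. \<Sum>y<q. f x y) = (\<Sum>(x, y)\<in>{..<m} \<times> {..<q}. f x y)"
    by (simp add: sum.cartesian_product)
  also have "\<dots> = (\<Sum>l<m * q. f (l div q) (l mod q))"
  proof (rule sum.reindex_bij_witness[of _ "\<lambda>l. (l div q, l mod q)" "\<lambda>(x, y). x * q + y"])
    fix a assume a: "a \<in> {..<m} \<times> {..<q}"
    then obtain x y where xy: "a = (x, y)" "x < m" "y < q" by auto
    have "x * q + y < Suc x * q" using xy by simp
    also have "\<dots> \<le> m * q" using xy by (intro mult_right_mono) auto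
    finally show "(case a of (x, y) \<Rightarrow> x * q + y) \<in> {..<m * q}" using xy by simp
  qed (auto simp: div_mod_less)
  finally show ?thesis by simp
qed

text \<open>After the inner index is split, the quotient part of the sum is an entry of
  \<open>A * C\<close> and the remainder part an entry of \<open>B * D\<close>.\<close>

lemma kron_mult:
  assumes A: "A \<in> carrier_mat m m" and B: "B \<in> carrier_mat q q"
    and C: "C \<in> carrier_mat m m" and D: "D \<in> carrier_mat q q"
  shows "kron A B * kron C D = kron (A * C) (B * D)"
proof (rule eq_matI)
  fix i j assume "i < dim_row (kron (A * C) (B * D))" "j < dim_col (kron (A * C) (B * D))"
  then have ij: "i < m * q" "j < m * q" using assms by (auto simp: kron_def)
  note k = kron_carrier[OF A B] kron_carrier[OF C D]
  have "(kron A B * kron C D) $$ (i, j) = (\<Sum>l<m * q. kron A B $$ (i, l) * kron C D $$ (l, j))"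
    using k ij by (simp add: scalar_prod_def lessThan_atLeast0)
  also have "\<dots> = (\<Sum>l<m * q. (A $$ (i div q, l div q) * C $$ (l div q, j div q)) *
      (B $$ (i mod q, l mod q) * D $$ (l mod q, j mod q)))"
    using ij assms by (intro sum.cong) (auto simp: kron_entry[of _ m m _ q q] mult_ac)
  also have "\<dots> = (\<Sum>x<m. A $$ (i div q, x) * C $$ (x, j div q)) * (\<Sum>y<q. B $$ (i mod q, y) * D $$ (y, j mod q))"
    by (subst sum_div_mod) (simp add: sum_product)
  also have "\<dots> = (A * C) $$ (i div q, j div q) * (B * D) $$ (i mod q, j mod q)"
    using ij[THEN div_mod_less(1)] ij[THEN div_mod_less(2)] assms
    by (simp add: scalar_prod_def lessThan_atLeast0)
  also have "\<dots> = kron (A * C) (B * D) $$ (i, j)"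
    using ij assms by (subst kron_entry[of _ m m _ q q]) auto
  finally show "(kron A B * kron C D) $$ (i, j) = kron (A * C) (B * D) $$ (i, j)" .
qed (use assms in \<open>auto simp: kron_def\<close>)

lemma kron_one: "kron (1\<^sub>m m) (1\<^sub>m q) = 1\<^sub>m (m * q)"
proof (rule eq_matI)
  fix i j assume "i < dim_row (1\<^sub>m (m * q))" "j < dim_col (1\<^sub>m (m * q))"
  then have ij: "i < m * q" "j < m * q" by auto
  have "i = j \<longleftrightarrow> i div q = j div q \<and> i mod q = j mod q" by (metis div_mult_mod_eq)
  then show "kron (1\<^sub>m m) (1\<^sub>m q) $$ (i, j) = 1\<^sub>m (m * q) $$ (i, j)"
    using ij div_mod_less[OF ij(1)] div_mod_less[OF ij(2)]
    by (subst kron_entry[of _ m m _ q q]) auto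
qed (auto simp: kron_def)

lemma kron_smult_right: "kron X (c \<cdot>\<^sub>m Y) = c \<cdot>\<^sub>m kron X Y"
proof (rule eq_matI)
  fix i j assume "i < dim_row (c \<cdot>\<^sub>m kron X Y)" "j < dim_col (c \<cdot>\<^sub>m kron X Y)"
  then have "i < dim_row X * dim_row Y" "j < dim_col X * dim_col Y" by (auto simp: kron_def)
  then show "kron X (c \<cdot>\<^sub>m Y) $$ (i, j) = (c \<cdot>\<^sub>m kron X Y) $$ (i, j)"
    using div_mod_less[of i] div_mod_less[of j] by (simp add: kron_def)
qed (auto simp: kron_def)

lemma kron_GLn:
  assumes "A \<in> GLn m" "B \<in> GLn q"
  shows "kron A B \<in> GLn (m * q)"
proof -
  obtain A' B' where *: "A' \<in> GLn m" "A * A' = 1\<^sub>m m" "B' \<in> GLn q" "B * B' = 1\<^sub>m q"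
    using GLn_inverse assms by metis
  note c = GLn_carrier[OF assms(1)] GLn_carrier[OF assms(2)] GLn_carrier[OF *(1)] GLn_carrier[OF *(3)]
  have "kron A B * kron A' B' = 1\<^sub>m (m * q)"
    using c * by (simp add: kron_mult[of _ m _ q] kron_one)
  then show ?thesis using c by (intro GLn_I[of _ _ "kron A' B'"]) (auto intro: kron_carrier)
qed

text \<open>The submatrix on the indices divisible by \<open>q\<close>. Since
  \<open>kron h (1\<^sub>m q)\<close> carries a copy of \<open>h\<close> on each residue class of
  indices, this one block already recovers \<open>h\<close>.\<close>

definition zero_block :: "nat \<Rightarrow> nat \<Rightarrow> 'a::field mat \<Rightarrow> 'a mat" where
  "zero_block m q Y = mat m m (\<lambda>(i, j). Y $$ (i * q, j * q))"

text \<open>Block diagonal once indices are grouped by residue modulo \<open>q\<close>; the residue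
  is the index of the second Kronecker factor.\<close>

definition residue_diagonal :: "nat \<Rightarrow> nat \<Rightarrow> 'a::field mat \<Rightarrow> bool" where
  "residue_diagonal m q Y \<longleftrightarrow> (\<forall>a<m * q. \<forall>b<m * q. a mod q \<noteq> b mod q \<longrightarrow> Y $$ (a, b) = 0)"

lemma zero_block_carrier: "zero_block m q Y \<in> carrier_mat m m"
  by (simp add: zero_block_def)

text \<open>In a row of residue 0, \<open>Y\<close> vanishes at every column of nonzero residue, so
  the sum for an entry of \<open>Y * Z\<close> retains only the inner indices that belong to the
  block.\<close>

lemma zero_block_mult:
  assumes Y: "Y \<in> carrier_mat (m * q) (m * q)" and Z: "Z \<in> carrier_mat (m * q) (m * q)"
    and "q > 0" and diag: "residue_diagonal m q Y"
  shows "zero_block m q (Y * Z) = zero_block m q Y * zero_block m q Z"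
proof (rule eq_matI)
  fix i j assume "i < dim_row (zero_block m q Y * zero_block m q Z)" "j < dim_col (zero_block m q Y * zero_block m q Z)"
  then have ij: "i < m" "j < m" by (auto simp: zero_block_def)
  then have ijq: "i * q < m * q" "j * q < m * q" using \<open>q > 0\<close> by auto
  have "zero_block m q (Y * Z) $$ (i, j) = (\<Sum>l<m * q. Y $$ (i * q, l) * Z $$ (l, j * q))"
    using ij ijq Y Z by (simp add: zero_block_def scalar_prod_def lessThan_atLeast0)
  also have "\<dots> = (\<Sum>l<m * q. if l mod q = 0 then Y $$ (i * q, l div q * q) * Z $$ (l div q * q, j * q) else 0)"
  proof (intro sum.cong refl)
    fix l assume l: "l \<in> {..<m * q}"
    show "Y $$ (i * q, l) * Z $$ (l, j * q) =
        (if l mod q = 0 then Y $$ (i * q, l div q * q) * Z $$ (l div q * q, j * q) else 0)"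
    proof (cases "l mod q = 0")
      case True
      then have "l div q * q = l" using div_mult_mod_eq[of l q] by simp
      then show ?thesis using True by simp
    next
      case False
      then show ?thesis using diag ijq l by (auto simp: residue_diagonal_def)
    qed
  qed
  also have "\<dots> = (\<Sum>x<m. \<Sum>y<q. if y = 0 then Y $$ (i * q, x * q) * Z $$ (x * q, j * q) else 0)"
    by (rule sum_div_mod)
  also have "\<dots> = (\<Sum>x<m. Y $$ (i * q, x * q) * Z $$ (x * q, j * q))"
    using \<open>q > 0\<close> by (intro sum.cong) (auto simp: sum.delta)
  also have "\<dots> = (zero_block m q Y * zero_block m q Z) $$ (i, j)"
    using ij by (simp add: zero_block_def scalar_prod_def lessThan_atLeast0)
  finally show "zero_block m q (Y * Z) $$ (i, j) = (zero_block m q Y * zero_block m q Z) $$ (i, j)" .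
qed (auto simp: zero_block_def)

lemma zero_block_one: "q > 0 \<Longrightarrow> zero_block m q (1\<^sub>m (m * q)) = 1\<^sub>m m"
  by (rule eq_matI) (auto simp: zero_block_def)

lemma zero_block_smult:
  assumes "Y \<in> carrier_mat (m * q) (m * q)" "q > 0"
  shows "zero_block m q (c \<cdot>\<^sub>m Y) = c \<cdot>\<^sub>m zero_block m q Y"
  using assms by (intro eq_matI) (auto simp: zero_block_def)

lemma zero_block_kron:
  assumes "h \<in> carrier_mat m m" "q > 0"
  shows "zero_block m q (kron h (1\<^sub>m q)) = h"
  using assms by (intro eq_matI) (auto simp: zero_block_def kron_entry[of _ m m _ q q])

lemma residue_diagonal_kron:
  assumes "h \<in> carrier_mat m m"
  shows "residue_diagonal m q (kron h (1\<^sub>m q))"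
  unfolding residue_diagonal_def
proof (intro allI impI)
  fix a b assume *: "a < m * q" "b < m * q" "a mod q \<noteq> b mod q"
  then show "kron h (1\<^sub>m q) $$ (a, b) = 0"
    using assms div_mod_less(2)[OF *(1)] div_mod_less(2)[OF *(2)]
    by (simp add: kron_entry[of _ m m _ q q])
qed

text \<open>Multiplicativity applied to \<open>Y\<close> and its inverse exhibits an inverse of the
  block.\<close>

lemma zero_block_GLn:
  assumes "Y \<in> GLn (m * q)" "q > 0" "residue_diagonal m q Y"
  shows "zero_block m q Y \<in> GLn m"
proof -
  obtain Z where Z: "Z \<in> GLn (m * q)" "Y * Z = 1\<^sub>m (m * q)" using GLn_inverse[OF assms(1)] by blast
  then have "zero_block m q Y * zero_block m q Z = 1\<^sub>m m"
    using zero_block_mult[OF GLn_carrier[OF assms(1)] GLn_carrier[OF Z(1)] assms(2,3)] assms(2)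
    by (simp add: zero_block_one)
  then show ?thesis by (intro GLn_I[OF zero_block_carrier zero_block_carrier])
qed

section \<open>The matrices \<open>Amat\<close> and \<open>Bmat\<close> in terms of binary
  digits\<close>

lemma flip_bit_flip_bit: "flip_bit s (flip_bit s (i :: nat)) = i"
  by (rule bit_eqI) (auto simp: bit_flip_bit_iff)

text \<open>With indices counted from 0, the permutation is the flip of binary digit
  \<open>s\<close>. This makes its involutivity and its effect on the signs of \<open>Amat\<close>
  evident.\<close>

lemma sigma_perm_Suc: "sigma_perm s (Suc i) = Suc (flip_bit s i)"
proof -
  have m: "i mod 2 ^ (s + 1) = 2 ^ s * (i div 2 ^ s mod 2) + i mod 2 ^ s"
    using mod_mult2_eq[of i "2 ^ s" 2] by (simp add: mult.commute)
  have lt: "i mod 2 ^ s < 2 ^ s" by simp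
  \<comment> \<open>If the lowest \<open>s + 1\<close> bits of \<open>i\<close> are all ones, the
    left residue wraps to 0, which lies outside the interval; bit \<open>s\<close> is then set, so
    the equivalence holds there too.\<close>
  have iff: "Suc i mod 2 ^ (s + 1) \<in> {1..2 ^ s} \<longleftrightarrow> \<not> bit i s"
  proof (cases "bit i s")
    case True
    then have "i mod 2 ^ (s + 1) = 2 ^ s + i mod 2 ^ s" using m by (simp add: bit_iff_odd odd_iff_mod_2_eq_one)
    then show ?thesis using True by (auto simp: mod_Suc)
  next
    case False
    define l where "l = i mod 2 ^ s"
    from False have "i mod 2 ^ (s + 1) = l" using m by (simp add: bit_iff_odd l_def)
    moreover have "l < 2 ^ s" using lt by (simp add: l_def)
    ultimately show ?thesis using False by (auto simp: mod_Suc Suc_le_eq)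
  qed
  show ?thesis
  proof (cases "bit i s")
    case True
    \<comment> \<open>The flipped number has bit \<open>s\<close> clear, so flipping back adds
      \<open>2 ^ s\<close>. This shows that the subtraction in \<open>sigma_perm\<close> is not
      truncated.\<close>
    then have "\<not> bit (flip_bit s i) s" by (simp add: bit_flip_bit_iff)
    then have "flip_bit s (flip_bit s i) = flip_bit s i + 2 ^ s"
      by (subst flip_bit_eq_if) (simp add: set_bit_eq)
    then have "i = flip_bit s i + 2 ^ s" by (simp add: flip_bit_flip_bit)
    then show ?thesis using True iff by (simp add: sigma_perm_def)
  next
    case False
    then show ?thesis using iff by (simp add: sigma_perm_def flip_bit_eq_if set_bit_eq)
  qed
qed

lemma Bmat_carrier: "Bmat r s \<in> carrier_mat (2 ^ r) (2 ^ r)"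
  by (simp add: Bmat_def)

lemma Amat_carrier: "Amat r s \<in> carrier_mat (2 ^ r) (2 ^ r)"
  by (simp add: Amat_def)

lemma Bmat_entry:
  "i < 2 ^ r \<Longrightarrow> j < 2 ^ r \<Longrightarrow> Bmat r s $$ (i, j) = (if j = flip_bit s i then 1 else 0)"
  by (auto simp: Bmat_def sigma_perm_Suc)

lemma Amat_entry:
  "i < 2 ^ r \<Longrightarrow> j < 2 ^ r \<Longrightarrow> Amat r s $$ (i, j) = (if i = j then if bit i s then -1 else 1 else 0)"
  by (auto simp: Amat_def bit_iff_odd)

lemma flip_bit_less:
  assumes "(i :: nat) < 2 ^ r" "s < r"
  shows "flip_bit s i < 2 ^ r"
proof -
  have "take_bit r (flip_bit s i) = flip_bit s i"
    using assms by (simp add: take_bit_flip_bit_eq take_bit_nat_eq_self)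
  then show ?thesis by (metis take_bit_nat_less_exp)
qed

lemma diagonal_mult_left:
  assumes M: "M \<in> carrier_mat n n" "\<And>i j. i < n \<Longrightarrow> j < n \<Longrightarrow> M $$ (i, j) = (if i = j then d i else 0)"
    and X: "X \<in> carrier_mat n n" and ij: "i < n" "j < n"
  shows "(M * X) $$ (i, j) = d i * X $$ (i, j)"
proof -
  have "(M * X) $$ (i, j) = (\<Sum>l<n. M $$ (i, l) * X $$ (l, j))"
    by (rule mult_mat_entry[OF M(1) X ij])
  also have "\<dots> = (\<Sum>l<n. if l = i then d i * X $$ (i, j) else 0)"
    using M(2) ij by (intro sum.cong) auto
  finally show ?thesis using ij by simp
qed

lemma diagonal_mult_right:
  assumes M: "M \<in> carrier_mat n n" "\<And>i j. i < n \<Longrightarrow> j < n \<Longrightarrow> M $$ (i, j) = (if i = j then d i else 0)"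
    and X: "X \<in> carrier_mat n n" and ij: "i < n" "j < n"
  shows "(X * M) $$ (i, j) = X $$ (i, j) * d j"
proof -
  have "(X * M) $$ (i, j) = (\<Sum>l<n. X $$ (i, l) * M $$ (l, j))"
    by (rule mult_mat_entry[OF X M(1) ij])
  also have "\<dots> = (\<Sum>l<n. if l = j then X $$ (i, j) * d j else 0)"
    using M(2) ij by (intro sum.cong) auto
  finally show ?thesis using ij by simp
qed

lemma Amat_mult_left:
  assumes "X \<in> carrier_mat (2 ^ r) (2 ^ r)" "i < 2 ^ r" "j < 2 ^ r"
  shows "(Amat r s * X) $$ (i, j) = (if bit i s then -1 else 1) * X $$ (i, j)"
  by (rule diagonal_mult_left[OF Amat_carrier _ assms]) (rule Amat_entry)

lemma Amat_mult_right:
  assumes "X \<in> carrier_mat (2 ^ r) (2 ^ r)" "i < 2 ^ r" "j < 2 ^ r"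
  shows "(X * Amat r s) $$ (i, j) = X $$ (i, j) * (if bit j s then -1 else 1)"
  by (rule diagonal_mult_right[OF Amat_carrier _ assms]) (rule Amat_entry)

lemma Amat_square: "Amat r s * Amat r s = 1\<^sub>m (2 ^ r)"
proof (rule eq_matI)
  fix i j assume "i < dim_row (1\<^sub>m (2 ^ r))" "j < dim_col (1\<^sub>m (2 ^ r))"
  then have ij: "i < 2 ^ r" "j < 2 ^ r" by auto
  show "(Amat r s * Amat r s) $$ (i, j) = 1\<^sub>m (2 ^ r) $$ (i, j)"
    unfolding Amat_mult_left[OF Amat_carrier ij] using ij by (simp add: Amat_entry)
qed (simp_all add: Amat_def)

lemma Bmat_square:
  assumes "s < r"
  shows "Bmat r s * Bmat r s = 1\<^sub>m (2 ^ r)"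
proof (rule eq_matI)
  fix i j assume "i < dim_row (1\<^sub>m (2 ^ r))" "j < dim_col (1\<^sub>m (2 ^ r))"
  then have ij: "i < 2 ^ r" "j < 2 ^ r" by auto
  have "(Bmat r s * Bmat r s) $$ (i, j) = (\<Sum>l<2 ^ r. Bmat r s $$ (i, l) * Bmat r s $$ (l, j))"
    by (rule mult_mat_entry[OF Bmat_carrier Bmat_carrier ij])
  also have "\<dots> = (\<Sum>l<2 ^ r. if l = flip_bit s i then if j = i then 1 else 0 else 0)"
    using ij by (intro sum.cong) (auto simp: Bmat_entry flip_bit_flip_bit)
  finally show "(Bmat r s * Bmat r s) $$ (i, j) = 1\<^sub>m (2 ^ r) $$ (i, j)"
    using ij flip_bit_less[OF ij(1) assms] by auto
qed (use Bmat_carrier in auto)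

text \<open>\<open>Amat r s'\<close> puts the sign given by bit \<open>s'\<close> on the diagonal,
  and flipping bit \<open>s\<close> changes that bit exactly when \<open>s = s'\<close>.\<close>

lemma Bmat_Amat:
  assumes "s < r"
  shows "Bmat r s * Amat r s' = (if s = s' then -1 else 1) \<cdot>\<^sub>m (Amat r s' * Bmat r s)"
proof (rule eq_matI)
  fix i j
  assume "i < dim_row ((if s = s' then -1 else 1) \<cdot>\<^sub>m (Amat r s' * Bmat r s))"
    "j < dim_col ((if s = s' then -1 else 1) \<cdot>\<^sub>m (Amat r s' * Bmat r s))"
  then have ij: "i < 2 ^ r" "j < 2 ^ r" by (auto simp: Amat_def Bmat_def)
  then have "((if s = s' then -1 else 1) \<cdot>\<^sub>m (Amat r s' * Bmat r s)) $$ (i, j) =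
      (if s = s' then -1 else 1) * (Amat r s' * Bmat r s) $$ (i, j)"
    by (intro index_smult_mat) (auto simp: Amat_def Bmat_def)
  then show "(Bmat r s * Amat r s') $$ (i, j) = ((if s = s' then -1 else 1) \<cdot>\<^sub>m (Amat r s' * Bmat r s)) $$ (i, j)"
    unfolding Amat_mult_left[OF Bmat_carrier ij] Amat_mult_right[OF Bmat_carrier ij]
    using ij by (auto simp: Bmat_entry bit_flip_bit_iff)
qed (simp_all add: Amat_def Bmat_def)

text \<open>The residue modulo \<open>2 ^ r\<close> is the number formed by the lowest
  \<open>r\<close> bits. Hence the signs of the matrices \<open>Amat r s\<close> together separate
  residues.\<close>

lemma mod_power2_eqI:
  assumes "\<And>s. s < r \<Longrightarrow> bit (a :: nat) s = bit b s"
  shows "a mod 2 ^ r = b mod 2 ^ r"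
proof -
  have "take_bit r a = take_bit r b"
    using assms by (intro bit_eqI) (auto simp: bit_take_bit_iff)
  then show ?thesis by (simp add: take_bit_eq_mod)
qed

subsection \<open>Centralizers\<close>

lemma (in group) subgroup_centralizer:
  assumes "S \<subseteq> carrier G"
  shows "subgroup (centralizer G S) G"
proof (rule subgroupI)
  show "centralizer G S \<subseteq> carrier G" by (auto simp: centralizer_def)
  have "\<one> \<in> centralizer G S" using assms by (auto simp: centralizer_def)
  then show "centralizer G S \<noteq> {}" by blast
next
  fix a assume a: "a \<in> centralizer G S"
  have "inv a \<otimes> x = x \<otimes> inv a" if "x \<in> S" for x
  proof -
    have c: "a \<in> carrier G" "x \<in> carrier G" "a \<otimes> x = x \<otimes> a" using a that assms by (auto simp: centralizer_def)
    have "inv a \<otimes> x = inv a \<otimes> (x \<otimes> a) \<otimes> inv a" using c(1,2) by (simp add: m_assoc)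
    also have "\<dots> = inv a \<otimes> (a \<otimes> x) \<otimes> inv a" by (simp only: c(3))
    also have "\<dots> = x \<otimes> inv a" using c(1,2) by (simp add: m_assoc[symmetric])
    finally show ?thesis .
  qed
  then show "inv a \<in> centralizer G S" using a by (auto simp: centralizer_def)
next
  fix a b assume ab: "a \<in> centralizer G S" "b \<in> centralizer G S"
  have "a \<otimes> b \<otimes> x = x \<otimes> (a \<otimes> b)" if "x \<in> S" for x
  proof -
    have c: "a \<in> carrier G" "b \<in> carrier G" "x \<in> carrier G" "a \<otimes> x = x \<otimes> a" "b \<otimes> x = x \<otimes> b"
      using ab that assms by (auto simp: centralizer_def)
    then show ?thesis by (metis m_assoc)
  qed
  then show "a \<otimes> b \<in> centralizer G S" using ab by (auto simp: centralizer_def)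
qed

lemma centralizer_singleton:
  "x \<in> centralizer G {g} \<longleftrightarrow> x \<in> carrier G \<and> x \<otimes>\<^bsub>G\<^esub> g = g \<otimes>\<^bsub>G\<^esub> x"
  unfolding centralizer_def by simp

text \<open>The identity lies in both factors, so \<open>A\<close> and \<open>T\<close> lie in the
  product set. Conversely, the elements commuting with a fixed \<open>g\<close> form a subgroup,
  which contains the generated group and its products with \<open>T\<close> as soon as it contains
  \<open>A\<close> and \<open>T\<close>.\<close>

lemma (in group) centralizer_generate_set_mult:
  assumes "A \<subseteq> carrier G" "T \<subseteq> carrier G" "\<one> \<in> T"
  shows "centralizer G (generate G A <#> T) = centralizer G (A \<union> T)"
proof (intro equalityI subsetI)
  fix g assume g: "g \<in> centralizer G (generate G A <#> T)"
  have "A \<union> T \<subseteq> generate G A <#> T"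
  proof
    fix x assume "x \<in> A \<union> T"
    then show "x \<in> generate G A <#> T"
    proof
      assume "x \<in> A"
      then have "x \<in> generate G A" "x = x \<otimes> \<one>" using assms by (auto intro: generate.incl)
      then show ?thesis using assms(3) unfolding set_mult_def by blast
    next
      assume "x \<in> T"
      moreover from this have "x = \<one> \<otimes> x" using assms by auto
      ultimately show ?thesis using generate.one[of G A] unfolding set_mult_def by blast
    qed
  qed
  then show "g \<in> centralizer G (A \<union> T)" using g by (auto simp: centralizer_def)
next
  fix g assume g: "g \<in> centralizer G (A \<union> T)"
  then have gc: "g \<in> carrier G" by (auto simp: centralizer_def)
  interpret C: subgroup "centralizer G {g}" G using gc by (intro subgroup_centralizer) auto
  have "A \<union> T \<subseteq> centralizer G {g}"
  proof
    fix x assume x: "x \<in> A \<union> T"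
    then have "g \<otimes> x = x \<otimes> g" using g unfolding centralizer_def by blast
    then have "x \<otimes> g = g \<otimes> x" by (rule sym)
    moreover have "x \<in> carrier G" using x assms by blast
    ultimately show "x \<in> centralizer G {g}" unfolding centralizer_singleton by blast
  qed
  moreover from this have "generate G A \<subseteq> centralizer G {g}"
    by (intro generate_subgroup_incl C.subgroup_axioms) auto
  ultimately have "generate G A <#> T \<subseteq> centralizer G {g}"
    unfolding set_mult_def using C.m_closed by blast
  then have "g \<otimes> x = x \<otimes> g" if "x \<in> generate G A <#> T" for x
  proof -
    have "x \<in> centralizer G {g}" using \<open>generate G A <#> T \<subseteq> _\<close> that by (rule subsetD)
    then have "x \<otimes> g = g \<otimes> x" unfolding centralizer_singleton by (rule conjunct2)
    then show ?thesis by (rule sym)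
  qed
  then show "g \<in> centralizer G (generate G A <#> T)"
    using gc unfolding centralizer_def by blast
qed

section \<open>Commutation up to a scalar\<close>

lemma GLn_smult_cancel:
  assumes "X \<in> GLn n" "n > 0" "a \<cdot>\<^sub>m X = b \<cdot>\<^sub>m X"
  shows "a = b"
proof -
  obtain Y where Y: "Y \<in> GLn n" "X * Y = 1\<^sub>m n" using GLn_inverse[OF assms(1)] by blast
  have "c \<cdot>\<^sub>m X * Y = c \<cdot>\<^sub>m 1\<^sub>m n" for c
    using Y mult_smult_assoc_mat[OF GLn_carrier[OF assms(1)] GLn_carrier[OF Y(1)]] by simp
  then have "a \<cdot>\<^sub>m 1\<^sub>m n = b \<cdot>\<^sub>m (1\<^sub>m n :: 'a mat)" using assms(3) by metis
  then have "(a \<cdot>\<^sub>m 1\<^sub>m n) $$ (0, 0) = (b \<cdot>\<^sub>m (1\<^sub>m n :: 'a mat)) $$ (0, 0)" by simp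
  then show ?thesis using assms(2) by simp
qed

text \<open>Moving \<open>X\<close> past \<open>M\<close> twice yields the factor
  \<open>c * c\<close>, but \<open>M * M\<close> is a nonzero scalar matrix and \<open>X\<close>
  passes it freely.\<close>

lemma commutator_scalar_sign:
  fixes X M :: "'a::field mat"
  assumes X: "X \<in> GLn n" and M: "M \<in> carrier_mat n n" and "n > 0"
    and sq: "M * M = \<mu> \<cdot>\<^sub>m 1\<^sub>m n" "\<mu> \<noteq> 0" and comm: "X * M = c \<cdot>\<^sub>m (M * X)"
  shows "c = 1 \<or> c = -1"
proof -
  note Xc = GLn_carrier[OF X]
  have MX: "M * X \<in> carrier_mat n n" using M Xc by auto
  have "\<mu> \<cdot>\<^sub>m X = X * (M * M)" using Xc mult_smult_distrib[OF Xc, of "1\<^sub>m n" n \<mu>] by (simp add: sq)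
  also have "\<dots> = X * M * M" using Xc M assoc_mult_mat[of X n n M n M n] by simp
  also have "\<dots> = c \<cdot>\<^sub>m (M * X * M)" unfolding comm using mult_smult_assoc_mat[OF MX M] by simp
  also have "M * X * M = M * (X * M)" using assoc_mult_mat[OF M Xc M] by simp
  also have "\<dots> = c \<cdot>\<^sub>m (M * (M * X))" unfolding comm using mult_smult_distrib[OF M MX] by simp
  also have "M * (M * X) = M * M * X" using assoc_mult_mat[OF M M Xc] by simp
  also have "\<dots> = \<mu> \<cdot>\<^sub>m X" using Xc mult_smult_assoc_mat[of "1\<^sub>m n" n n X n \<mu>] by (simp add: sq)
  finally have "\<mu> \<cdot>\<^sub>m X = (c * c * \<mu>) \<cdot>\<^sub>m X" by (simp add: smult_smult_mat mult.assoc)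
  then have "\<mu> = c * c * \<mu>" using GLn_smult_cancel[OF X \<open>n > 0\<close>] by blast
  then have "c * c = 1" using sq(2) by auto
  then show ?thesis by (simp add: square_eq_1_iff)
qed

lemma pcl_in_centralizer_iff:
  assumes "X \<in> GLn n" "\<M> \<subseteq> carrier_mat n n"
  shows "pcl X \<in> centralizer (PGL n) (pcl ` \<M>) \<longleftrightarrow> (\<forall>M\<in>\<M>. \<exists>c. c \<noteq> 0 \<and> X * M = c \<cdot>\<^sub>m (M * X))"
proof -
  have "pcl X \<in> centralizer (PGL n) (pcl ` \<M>) \<longleftrightarrow>
      (\<forall>M\<in>\<M>. pcl X \<otimes>\<^bsub>PGL n\<^esub> pcl M = pcl M \<otimes>\<^bsub>PGL n\<^esub> pcl X)"
    using assms(1) by (simp add: centralizer_def pcl_in_PGL)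
  also have "\<dots> \<longleftrightarrow> (\<forall>M\<in>\<M>. \<exists>c. c \<noteq> 0 \<and> X * M = c \<cdot>\<^sub>m (M * X))"
    using assms GLn_carrier[OF assms(1)] by (intro ball_cong refl pcl_commute_iff) auto
  finally show ?thesis .
qed

text \<open>The commutator with h is a continuous sign on the centralizer, hence constant.\<close>
lemma connected_centralizer_commute:
  fixes h X :: "'a::field mat"
  assumes two: "(2 :: 'a) \<noteq> 0" and "k > 0"
    and H: "\<And>x. x \<in> H \<Longrightarrow> x \<otimes>\<^bsub>PGL k\<^esub> x = \<one>\<^bsub>PGL k\<^esub>" "H \<subseteq> carrier (PGL k)"
    and conn: "connectedin (pgl_top k) (centralizer (PGL k) H)"
    and h: "h \<in> GLn k" "pcl h \<in> H" and X: "X \<in> GLn k" "pcl X \<in> centralizer (PGL k) H"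
  shows "X * h = h * X"
proof (rule ccontr)
  assume neq: "X * h \<noteq> h * X"
  note hc = GLn_carrier[OF h(1)]
  let ?C = "centralizer (PGL k) H"
  \<comment> \<open>On the centralizer the commutator with \<open>h\<close> is 1 or -1, so there
    \<open>U 1\<close> is the locus of value -1 and \<open>U (-1)\<close> the locus of value 1.
    Defining them by inequations makes both open.\<close>
  define U where "U c = pcl ` {A \<in> GLn k. A * h \<noteq> c \<cdot>\<^sub>m (h * A)}" for c
  have mem_U: "pcl A \<in> U c \<longleftrightarrow> A * h \<noteq> c \<cdot>\<^sub>m (h * A)" if A: "A \<in> GLn k" for A c
  proof
    assume "pcl A \<in> U c"
    then obtain B where B: "B \<in> GLn k" "B * h \<noteq> c \<cdot>\<^sub>m (h * B)" "pcl B = pcl A" unfolding U_def by auto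
    then obtain d where d: "d \<noteq> 0" "B = d \<cdot>\<^sub>m A" by (auto simp: pcl_eq_iff)
    have "B * h = d \<cdot>\<^sub>m (A * h)" "h * B = d \<cdot>\<^sub>m (h * A)"
      unfolding d using mult_smult_assoc_mat[OF GLn_carrier[OF A] hc] mult_smult_distrib[OF hc GLn_carrier[OF A]] by auto
    then show "A * h \<noteq> c \<cdot>\<^sub>m (h * A)" using B(2) by (auto simp: smult_smult_mat mult.commute)
  qed (use A in \<open>auto simp: U_def\<close>)
  have "openin (pgl_top k) (U c)" for c
  proof -
    have "{A \<in> GLn k. pcl A \<notin> U c} = {A \<in> GLn k. A * h = c \<cdot>\<^sub>m (h * A)}" using mem_U by auto
    then show ?thesis unfolding openin_pgl_top
      using GL_closed_commute_up_to_scalar[OF hc, of c] by (auto simp: U_def carrier_PGL)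
  qed
  moreover have "?C \<subseteq> U 1 \<union> U (-1)"
  proof
    fix x assume "x \<in> ?C"
    then obtain A where A: "x = pcl A" "A \<in> GLn k" by (auto simp: centralizer_def carrier_PGL)
    have "\<not> (A * h = 1 \<cdot>\<^sub>m (h * A) \<and> A * h = (-1) \<cdot>\<^sub>m (h * A))"
    proof
      assume "A * h = 1 \<cdot>\<^sub>m (h * A) \<and> A * h = (-1) \<cdot>\<^sub>m (h * A)"
      then have "1 \<cdot>\<^sub>m (h * A) = (-1) \<cdot>\<^sub>m (h * A)" by metis
      then have "1 = (- 1 :: 'a)" by (rule GLn_smult_cancel[OF GLn_mult[OF h(1) A(2)] \<open>k > 0\<close>])
      then have "(1 :: 'a) + 1 = 0" by (simp add: eq_neg_iff_add_eq_0)
      then show False using two by simp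
    qed
    then show "x \<in> U 1 \<union> U (-1)" using A mem_U by auto
  qed
  moreover have "U 1 \<inter> U (-1) \<inter> ?C = {}"
  proof -
    have "x \<notin> U 1 \<inter> U (-1)" if "x \<in> ?C" for x
    proof -
      obtain A where A: "x = pcl A" "A \<in> GLn k" using \<open>x \<in> ?C\<close> by (auto simp: centralizer_def carrier_PGL)
      have "pcl A \<otimes>\<^bsub>PGL k\<^esub> pcl h = pcl h \<otimes>\<^bsub>PGL k\<^esub> pcl A" using that h(2) A by (auto simp: centralizer_def)
      then obtain c where c: "A * h = c \<cdot>\<^sub>m (h * A)" using pcl_commute_iff[OF GLn_carrier[OF A(2)] hc] by blast
      have "pcl (h * h) = pcl (1\<^sub>m k)" using H(1)[OF h(2)] by (simp add: mult_PGL[OF hc hc] one_PGL)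
      then obtain \<mu> where "\<mu> \<noteq> 0" "h * h = \<mu> \<cdot>\<^sub>m 1\<^sub>m k" by (auto simp: pcl_eq_iff)
      then have "c = 1 \<or> c = -1" using commutator_scalar_sign[OF A(2) hc \<open>k > 0\<close> _ _ c] by blast
      then show ?thesis using c A mem_U by auto
    qed
    then show ?thesis by blast
  qed
  moreover have "U 1 \<inter> ?C \<noteq> {}"
    using X(2) mem_U[OF X(1), of 1] neq unfolding one_smult_mat by blast
  \<comment> \<open>The identity witnesses the value 1: it centralizes \<open>H\<close>, and
    \<open>h\<close> differs from its negative because \<open>h\<close> is invertible and 2 is
    nonzero. The assumed \<open>X\<close> witnesses the value -1.\<close>
  moreover have "U (-1) \<inter> ?C \<noteq> {}"
  proof -
    have "pcl (1\<^sub>m k) \<in> ?C"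
      using group.subgroup_centralizer[OF group_PGL H(2)] subgroup.one_closed one_PGL by metis
    moreover have "pcl (1\<^sub>m k) \<in> U (-1)"
    proof -
      have "h \<noteq> (-1) \<cdot>\<^sub>m h"
      proof
        assume "h = (-1) \<cdot>\<^sub>m h"
        then have "1 \<cdot>\<^sub>m h = (-1) \<cdot>\<^sub>m h" by (simp add: one_smult_mat)
        then have "1 = (- 1 :: 'a)" by (rule GLn_smult_cancel[OF h(1) \<open>k > 0\<close>])
        then have "(1 :: 'a) + 1 = 0" by (simp add: eq_neg_iff_add_eq_0)
        then show False using two by simp
      qed
      then show ?thesis using mem_U[OF GLn_one] hc by simp
    qed
    ultimately show ?thesis by blast
  qed
  ultimately have "\<exists>E1 E2. openin (pgl_top k) E1 \<and> openin (pgl_top k) E2 \<and> ?C \<subseteq> E1 \<union> E2 \<and>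
      E1 \<inter> E2 \<inter> ?C = {} \<and> E1 \<inter> ?C \<noteq> {} \<and> E2 \<inter> ?C \<noteq> {}"
    by (intro exI[of _ "U 1"] exI[of _ "U (-1)"] conjI)
  then show False using conn unfolding connectedin by simp
qed

text \<open>Since \<open>s < r\<close>, bit \<open>s\<close> of an index is a bit of its remainder
  modulo \<open>2 ^ r\<close>, so the sign can be read off from the full index.\<close>

lemma Abar_matrix_entry:
  assumes "s < r" "i < k * 2 ^ r" "j < k * 2 ^ r"
  shows "kron (1\<^sub>m k) (Amat r s) $$ (i, j) = (if i = j then if bit i s then -1 else 1 else 0)"
proof -
  have "i = j \<longleftrightarrow> i div 2 ^ r = j div 2 ^ r \<and> i mod 2 ^ r = j mod 2 ^ r" by (metis div_mult_mod_eq)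
  moreover have "bit (i mod 2 ^ r) s = bit i s"
    using assms(1) by (simp add: take_bit_eq_mod[symmetric] bit_take_bit_iff)
  ultimately show ?thesis
    using assms div_mod_less[OF assms(2)] div_mod_less[OF assms(3)]
    by (subst kron_entry[OF one_carrier_mat Amat_carrier]) (auto simp: Amat_entry)
qed

text \<open>Indices with different residues differ in some bit \<open>s < r\<close>. The matrix for
  that \<open>s\<close> has opposite signs at the two indices, so commuting with it makes the entry
  its own negative.\<close>

lemma residue_diagonal_if_commutes:
  fixes Y :: "'a::field mat"
  assumes two: "(2 :: 'a) \<noteq> 0" and Y: "Y \<in> carrier_mat (k * 2 ^ r) (k * 2 ^ r)"
    and comm: "\<And>s. s < r \<Longrightarrow> Y * kron (1\<^sub>m k) (Amat r s) = kron (1\<^sub>m k) (Amat r s) * Y"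
  shows "residue_diagonal k (2 ^ r) Y"
  unfolding residue_diagonal_def
proof (intro allI impI)
  fix a b assume ab: "a < k * 2 ^ r" "b < k * 2 ^ r" "a mod 2 ^ r \<noteq> b mod 2 ^ r"
  then obtain s where s: "s < r" "bit a s \<noteq> bit b s" using mod_power2_eqI by blast
  note carr = kron_carrier[OF one_carrier_mat Amat_carrier, of k r s]
  have "Y $$ (a, b) * (if bit b s then -1 else 1) = (if bit a s then -1 else 1) * Y $$ (a, b)"
  proof -
    have "(Y * kron (1\<^sub>m k) (Amat r s)) $$ (a, b) = Y $$ (a, b) * (if bit b s then -1 else 1)"
      by (rule diagonal_mult_right[OF carr _ Y ab(1,2)]) (rule Abar_matrix_entry[OF s(1)])
    moreover have "(kron (1\<^sub>m k) (Amat r s) * Y) $$ (a, b) = (if bit a s then -1 else 1) * Y $$ (a, b)"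
      by (rule diagonal_mult_left[OF carr _ Y ab(1,2)]) (rule Abar_matrix_entry[OF s(1)])
    ultimately show ?thesis by (simp only: comm[OF s(1)])
  qed
  then have "Y $$ (a, b) = - Y $$ (a, b)" using s(2) by (auto split: if_splits)
  then have "2 * Y $$ (a, b) = 0" by (metis add.right_inverse mult_2)
  then show "Y $$ (a, b) = 0" using two by simp
qed

subsection \<open>The centralizer of D\<close>

context
  fixes k r n :: nat and H :: "'a::field mat set set"
  assumes n: "n = k * 2 ^ r"
begin

abbreviation (input) A_lift :: "nat \<Rightarrow> 'a mat" where "A_lift s \<equiv> kron (1\<^sub>m k) (Amat r s)"
abbreviation (input) B_lift :: "nat \<Rightarrow> 'a mat" where "B_lift s \<equiv> kron (1\<^sub>m k) (Bmat r s)"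
abbreviation (input) H_lift :: "'a mat \<Rightarrow> 'a mat" where "H_lift h \<equiv> kron h (1\<^sub>m (2 ^ r))"

lemma A_lift_carrier: "A_lift s \<in> carrier_mat n n"
  unfolding n by (rule kron_carrier[OF one_carrier_mat Amat_carrier])

lemma B_lift_carrier: "B_lift s \<in> carrier_mat n n"
  unfolding n by (rule kron_carrier[OF one_carrier_mat Bmat_carrier])

lemma A_lift_square: "A_lift s * A_lift s = 1\<^sub>m n"
  unfolding n by (simp add: kron_mult[OF one_carrier_mat Amat_carrier one_carrier_mat Amat_carrier] Amat_square kron_one)

lemma B_lift_square: "s < r \<Longrightarrow> B_lift s * B_lift s = 1\<^sub>m n"
  unfolding n by (simp add: kron_mult[OF one_carrier_mat Bmat_carrier one_carrier_mat Bmat_carrier] Bmat_square kron_one)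

lemma A_lift_GLn: "A_lift s \<in> GLn n"
  by (rule GLn_I[OF A_lift_carrier A_lift_carrier A_lift_square])

lemma B_lift_GLn: "s < r \<Longrightarrow> B_lift s \<in> GLn n"
  by (rule GLn_I[OF B_lift_carrier B_lift_carrier B_lift_square])

lemma H_lift_GLn: "h \<in> GLn k \<Longrightarrow> H_lift h \<in> GLn n"
  unfolding n by (rule kron_GLn[OF _ GLn_one])

lemma B_lift_A_lift: "s < r \<Longrightarrow> B_lift s * A_lift s' = (if s = s' then -1 else 1) \<cdot>\<^sub>m (A_lift s' * B_lift s)"
  by (simp only: kron_mult[OF one_carrier_mat Bmat_carrier one_carrier_mat Amat_carrier]
      kron_mult[OF one_carrier_mat Amat_carrier one_carrier_mat Bmat_carrier] Bmat_Amat kron_smult_right)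

lemma B_lift_H_lift: "h \<in> carrier_mat k k \<Longrightarrow> B_lift s * H_lift h = H_lift h * B_lift s"
  by (simp add: kron_mult[of _ k _ "2 ^ r"] Bmat_carrier left_mult_one_mat[of _ k k] right_mult_one_mat[of _ k k]
      left_mult_one_mat[OF Bmat_carrier] right_mult_one_mat[OF Bmat_carrier])

text \<open>For the first factor of \<open>D\<close> the generators suffice, while \<open>H\<close>
  contributes all representatives of all its elements. Centralizing \<open>D\<close> means commuting
  with these matrices up to scalars.\<close>

definition D_lifts :: "'a mat set" where
  "D_lifts = A_lift ` {0..<r} \<union> {H_lift h | h. pcl h \<in> H \<and> h \<in> GLn k}"

lemma D_lifts_GLn: "D_lifts \<subseteq> GLn n"
  unfolding D_lifts_def using A_lift_GLn H_lift_GLn by blast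

lemma D_lifts_carrier: "D_lifts \<subseteq> carrier_mat n n"
  using D_lifts_GLn GLn_carrier by blast

lemma pcl_D_lifts: "pcl ` D_lifts = Abar k r ` {0..<r} \<union> tensor_id k r H"
  unfolding D_lifts_def tensor_id_def Abar_def by (auto simp: image_Un image_image)

lemma centralizer_eq_D_lifts:
  assumes "\<one>\<^bsub>PGL k\<^esub> \<in> H"
  shows "centralizer (PGL n) (Dgrp k r <#>\<^bsub>PGL n\<^esub> tensor_id k r H) = centralizer (PGL n) (pcl ` D_lifts)"
proof -
  have "Abar k r ` {0..<r} \<union> tensor_id k r H \<subseteq> carrier (PGL n)"
    unfolding pcl_D_lifts[symmetric] carrier_PGL using D_lifts_GLn by blast
  moreover have "\<one>\<^bsub>PGL n\<^esub> \<in> tensor_id k r H"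
    using assms GLn_one[of k] unfolding tensor_id_def n one_PGL kron_one[symmetric] by blast
  ultimately show ?thesis
    unfolding pcl_D_lifts Dgrp_def n mult.commute[of "2 ^ r"]
    by (intro group.centralizer_generate_set_mult[OF group_PGL]) auto
qed

text \<open>The commutator scalar is a sign for the lifts of \<open>A_s\<close> and 1 for the lifts
  of \<open>H\<close>, where the two matrices act on different tensor factors.\<close>

lemma Bbar_in_centralizer:
  assumes "s < r"
  shows "Bbar k r s \<in> centralizer (PGL n) (pcl ` D_lifts)"
  unfolding Bbar_def pcl_in_centralizer_iff[OF B_lift_GLn[OF assms] D_lifts_carrier]
proof
  fix M assume "M \<in> D_lifts"
  then consider s' where "M = A_lift s'" | h where "M = H_lift h" "h \<in> GLn k"
    unfolding D_lifts_def by blast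
  then show "\<exists>c. c \<noteq> 0 \<and> B_lift s * M = c \<cdot>\<^sub>m (M * B_lift s)"
  proof cases
    case 1
    then show ?thesis
      using B_lift_A_lift[OF assms, of s'] by (intro exI[of _ "if s = s' then -1 else 1"]) auto
  next
    case 2
    then show ?thesis
      using B_lift_H_lift[OF GLn_carrier[OF 2(2)], of s] by (intro exI[of _ 1]) (simp add: one_smult_mat)
  qed
qed

lemma Bgrp_subset_centralizer: "Bgrp k r \<subseteq> centralizer (PGL n) (pcl ` D_lifts)"
proof -
  have "pcl ` D_lifts \<subseteq> carrier (PGL n)" unfolding carrier_PGL using D_lifts_GLn by blast
  then have "subgroup (centralizer (PGL n) (pcl ` D_lifts)) (PGL n)"
    by (rule group.subgroup_centralizer[OF group_PGL])
  then show ?thesis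
    unfolding Bgrp_def mult.commute[of "2 ^ r"] n[symmetric]
    using Bbar_in_centralizer by (intro group.generate_subgroup_incl[OF group_PGL]) auto
qed

text \<open>Induction on the number \<open>m\<close> of matrices \<open>A_lift s\<close> that
  already commute with \<open>Y\<close>. If the next sign is -1, right multiplication by
  \<open>B_lift m\<close> corrects it without disturbing the earlier ones.\<close>

lemma adjust_by_Bgrp:
  assumes "n > 0" "m \<le> r" and X: "X \<in> GLn n" "pcl X \<in> centralizer (PGL n) (pcl ` D_lifts)"
  shows "\<exists>Y\<in>GLn n. \<exists>b\<in>Bgrp k r. pcl Y \<in> centralizer (PGL n) (pcl ` D_lifts) \<and>
    pcl X = pcl Y \<otimes>\<^bsub>PGL n\<^esub> b \<and> (\<forall>s<m. Y * A_lift s = A_lift s * Y)"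
  using \<open>m \<le> r\<close>
proof (induction m)
  case 0
  interpret group "PGL n" by (rule group_PGL)
  have "pcl X = pcl X \<otimes>\<^bsub>PGL n\<^esub> \<one>\<^bsub>PGL n\<^esub>" using pcl_in_PGL[OF X(1)] by simp
  moreover have "\<one>\<^bsub>PGL n\<^esub> \<in> Bgrp k r"
    unfolding Bgrp_def mult.commute[of "2 ^ r"] n[symmetric] by (rule generate.one)
  ultimately show ?case using X by blast
next
  case (Suc m)
  interpret group "PGL n" by (rule group_PGL)
  let ?C = "centralizer (PGL n) (pcl ` D_lifts)"
  obtain Y b where Y: "Y \<in> GLn n" "pcl Y \<in> ?C" and b: "b \<in> Bgrp k r"
    and eq: "pcl X = pcl Y \<otimes>\<^bsub>PGL n\<^esub> b" and comm: "\<And>s. s < m \<Longrightarrow> Y * A_lift s = A_lift s * Y"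
    using Suc by auto
  have m: "m < r" using Suc.prems by simp
  note Yc = GLn_carrier[OF Y(1)]
  have "A_lift m \<in> D_lifts" unfolding D_lifts_def using m by auto
  then obtain c where c: "Y * A_lift m = c \<cdot>\<^sub>m (A_lift m * Y)"
    using pcl_in_centralizer_iff[OF Y(1) D_lifts_carrier] Y(2) by blast
  have "c = 1 \<or> c = -1"
    by (rule commutator_scalar_sign[OF Y(1) A_lift_carrier \<open>n > 0\<close> _ _ c, where \<mu> = 1])
      (simp_all add: A_lift_square one_smult_mat)
  then show ?case
  proof
    assume "c = 1"
    then have "\<forall>s<Suc m. Y * A_lift s = A_lift s * Y"
      using c comm by (auto simp: less_Suc_eq one_smult_mat)
    then show ?thesis using Y b eq by blast
  next
    assume "c = -1"
    let ?Z = "Y * B_lift m"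
    have Z: "?Z \<in> GLn n" using Y(1) B_lift_GLn[OF m] by (rule GLn_mult)
    have pZ: "pcl ?Z = pcl Y \<otimes>\<^bsub>PGL n\<^esub> Bbar k r m"
      unfolding Bbar_def mult_PGL[OF Yc B_lift_carrier] ..
    have "?Z * A_lift s = A_lift s * ?Z" if "s < Suc m" for s
    proof -
      \<comment> \<open>The same sign arises from moving \<open>A_lift s\<close> past
        \<open>Y\<close> and past \<open>B_lift m\<close>, so its square, 1, remains.\<close>
      let ?d = "if m = s then -1 else 1 :: 'a"
      have Ys: "Y * A_lift s = ?d \<cdot>\<^sub>m (A_lift s * Y)"
      proof (cases "s = m")
        case True
        then show ?thesis using c \<open>c = -1\<close> by simp
      next
        case False
        then show ?thesis using comm[of s] that by (simp add: one_smult_mat)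
      qed
      have "?Z * A_lift s = Y * (B_lift m * A_lift s)" by (rule assoc_mult_mat[OF Yc B_lift_carrier A_lift_carrier])
      also have "\<dots> = ?d \<cdot>\<^sub>m (Y * (A_lift s * B_lift m))"
        unfolding B_lift_A_lift[OF m] by (rule mult_smult_distrib[OF Yc]) (rule mult_carrier_mat[OF A_lift_carrier B_lift_carrier])
      also have "Y * (A_lift s * B_lift m) = Y * A_lift s * B_lift m" by (rule assoc_mult_mat[OF Yc A_lift_carrier B_lift_carrier, symmetric])
      also have "\<dots> = ?d \<cdot>\<^sub>m (A_lift s * Y * B_lift m)"
        unfolding Ys by (rule mult_smult_assoc_mat[OF _ B_lift_carrier]) (rule mult_carrier_mat[OF A_lift_carrier Yc])
      also have "A_lift s * Y * B_lift m = A_lift s * ?Z" by (rule assoc_mult_mat[OF A_lift_carrier Yc B_lift_carrier])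
      also have "?d \<cdot>\<^sub>m (?d \<cdot>\<^sub>m (A_lift s * ?Z)) = A_lift s * ?Z"
        by (simp add: smult_smult_mat one_smult_mat)
      finally show ?thesis .
    qed
    moreover have "pcl ?Z \<in> ?C"
    proof -
      have "pcl ` D_lifts \<subseteq> carrier (PGL n)" unfolding carrier_PGL using D_lifts_GLn by blast
      then interpret C: subgroup ?C "PGL n" by (rule subgroup_centralizer)
      show ?thesis unfolding pZ using Y(2) Bbar_in_centralizer[OF m] by (rule C.m_closed)
    qed
    moreover have "Bbar k r m \<otimes>\<^bsub>PGL n\<^esub> b \<in> Bgrp k r"
      using b m unfolding Bgrp_def mult.commute[of "2 ^ r"] n[symmetric]
      by (intro generate.eng) (auto intro: generate.incl)
    \<comment> \<open>\<open>Bbar k r m\<close> is an involution, so one copy can be attached to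
      \<open>Y\<close> and another to \<open>b\<close> without changing the product.\<close>
    moreover have "pcl X = pcl ?Z \<otimes>\<^bsub>PGL n\<^esub> (Bbar k r m \<otimes>\<^bsub>PGL n\<^esub> b)"
    proof -
      have B: "(Bbar k r m :: 'a mat set) \<in> carrier (PGL n)" unfolding Bbar_def by (rule pcl_in_PGL[OF B_lift_GLn[OF m]])
      have Bsq: "(Bbar k r m :: 'a mat set) \<otimes>\<^bsub>PGL n\<^esub> Bbar k r m = \<one>\<^bsub>PGL n\<^esub>"
        unfolding Bbar_def mult_PGL[OF B_lift_carrier B_lift_carrier] B_lift_square[OF m] one_PGL ..
      have bc: "b \<in> carrier (PGL n)"
        using b Bgrp_subset_centralizer by (auto simp: centralizer_def)
      note Yp = pcl_in_PGL[OF Y(1)]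
      have "pcl ?Z \<otimes>\<^bsub>PGL n\<^esub> (Bbar k r m \<otimes>\<^bsub>PGL n\<^esub> b)
          = pcl Y \<otimes>\<^bsub>PGL n\<^esub> (Bbar k r m \<otimes>\<^bsub>PGL n\<^esub> Bbar k r m) \<otimes>\<^bsub>PGL n\<^esub> b"
        unfolding pZ using Yp B bc by (simp add: m_assoc)
      then show ?thesis unfolding eq Bsq using Yp by simp
    qed
    ultimately show ?thesis using Z by blast
  qed
qed

text \<open>Every invertible point of the line through the identity and \<open>Y\<close> commutes
  with all lifts. The classes of these points form a connected subset of the centralizer containing
  both ends.\<close>

lemma pcl_in_identity_component:
  assumes inf: "infinite (UNIV :: 'a set)" and Y: "Y \<in> GLn n" and comm: "\<And>M. M \<in> D_lifts \<Longrightarrow> Y * M = M * Y"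
  shows "pcl Y \<in> identity_component n (centralizer (PGL n) (pcl ` D_lifts))"
proof -
  note Yc = GLn_carrier[OF Y]
  let ?T = "pcl ` mat_line Y ` {z. det (mat_line Y z) \<noteq> 0}"
  have "pcl (mat_line Y z) \<in> centralizer (PGL n) (pcl ` D_lifts)" if "det (mat_line Y z) \<noteq> 0" for z
  proof -
    have L: "mat_line Y z \<in> GLn n" using that mat_line_carrier[OF Yc] by (simp add: GLn_def)
    show ?thesis unfolding pcl_in_centralizer_iff[OF L D_lifts_carrier]
    proof
      fix M assume "M \<in> D_lifts"
      then have "mat_line Y z * M = M * mat_line Y z"
        using mat_line_commute[OF Yc _ comm] D_lifts_carrier by blast
      then show "\<exists>c. c \<noteq> 0 \<and> mat_line Y z * M = c \<cdot>\<^sub>m (M * mat_line Y z)"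
        by (intro exI[of _ 1]) (simp add: one_smult_mat)
    qed
  qed
  then have sub: "?T \<subseteq> centralizer (PGL n) (pcl ` D_lifts)" by blast
  have "pcl (1\<^sub>m n) \<in> ?T"
    using mat_line_0[OF Yc] by (intro image_eqI[of _ _ "1\<^sub>m n"] image_eqI[of _ _ 0]) auto
  moreover have "pcl Y \<in> ?T"
    using mat_line_1[OF Yc] Y by (intro image_eqI[of _ _ Y] image_eqI[of _ _ 1]) (auto simp: GLn_def)
  moreover have "connectedin (subtopology (pgl_top n) (centralizer (PGL n) (pcl ` D_lifts))) ?T"
    unfolding connectedin_subtopology using connectedin_pcl_mat_line[OF inf Yc] sub by blast
  ultimately have "connected_component_of (subtopology (pgl_top n) (centralizer (PGL n) (pcl ` D_lifts))) (pcl (1\<^sub>m n)) (pcl Y)"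
    unfolding connected_component_of_def by blast
  then show ?thesis unfolding identity_component_def one_PGL by simp
qed

text \<open>The scalar between \<open>Y\<close> and \<open>H_lift h\<close> is also the scalar
  between the zero block of \<open>Y\<close> and \<open>h\<close>, which reduces the claim to
  \<open>PGL k\<close>. There either \<open>h\<close> is a scalar matrix or connectedness of the
  centralizer of \<open>H\<close> applies.\<close>

lemma commutes_with_tensor:
  assumes two: "(2 :: 'a) \<noteq> 0" and "k > 0"
    and H: "H = {\<one>\<^bsub>PGL k\<^esub>} \<or>
         (elem_abelian_2_subgroup (PGL k) H \<and> connectedin (pgl_top k) (centralizer (PGL k) H))"
    and Y: "Y \<in> GLn n" "pcl Y \<in> centralizer (PGL n) (pcl ` D_lifts)"
    and comm: "\<And>s. s < r \<Longrightarrow> Y * A_lift s = A_lift s * Y"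
    and h: "h \<in> GLn k" "pcl h \<in> H"
  shows "Y * H_lift h = H_lift h * Y"
proof -
  have q: "(2 :: nat) ^ r > 0" by simp
  let ?Y0 = "zero_block k (2 ^ r) Y"
  note Yc = GLn_carrier[OF Y(1)]
  have rd: "residue_diagonal k (2 ^ r) Y"
    using Yc comm unfolding n by (rule residue_diagonal_if_commutes[OF two])
  have Y0: "?Y0 \<in> GLn k" using Y(1) q rd unfolding n by (rule zero_block_GLn)
  \<comment> \<open>Stated for every \<open>g\<close> over \<open>H\<close>, not just for
    \<open>h\<close>: all of them are needed for the class of the block to centralize
    \<open>H\<close>.\<close>
  have block: "\<exists>c. c \<noteq> 0 \<and> Y * H_lift g = c \<cdot>\<^sub>m (H_lift g * Y) \<and> ?Y0 * g = c \<cdot>\<^sub>m (g * ?Y0)"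
    if g: "g \<in> GLn k" "pcl g \<in> H" for g
  proof -
    note gc = GLn_carrier[OF g(1)]
    note Hc = GLn_carrier[OF H_lift_GLn[OF g(1)]]
    have "H_lift g \<in> D_lifts" unfolding D_lifts_def using g by blast
    then obtain c where c: "c \<noteq> 0" "Y * H_lift g = c \<cdot>\<^sub>m (H_lift g * Y)"
      using pcl_in_centralizer_iff[OF Y(1) D_lifts_carrier] Y(2) by blast
    have "zero_block k (2 ^ r) (Y * H_lift g) = ?Y0 * g"
      using zero_block_mult[OF Yc[unfolded n] Hc[unfolded n] q rd] zero_block_kron[OF gc q] by simp
    moreover have "zero_block k (2 ^ r) (H_lift g * Y) = g * ?Y0"
      using zero_block_mult[OF Hc[unfolded n] Yc[unfolded n] q residue_diagonal_kron[OF gc]]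
        zero_block_kron[OF gc q] by simp
    moreover have "zero_block k (2 ^ r) (c \<cdot>\<^sub>m (H_lift g * Y)) = c \<cdot>\<^sub>m zero_block k (2 ^ r) (H_lift g * Y)"
      using mult_carrier_mat[OF Hc Yc] q unfolding n by (rule zero_block_smult)
    ultimately show ?thesis using c by metis
  qed
  have "?Y0 * h = h * ?Y0"
    using H
  proof
    assume "H = {\<one>\<^bsub>PGL k\<^esub>}"
    then have "pcl h = pcl (1\<^sub>m k)" using h(2) by (simp add: one_PGL)
    then obtain c where "h = c \<cdot>\<^sub>m 1\<^sub>m k" by (auto simp: pcl_eq_iff)
    then show ?thesis
      using zero_block_carrier[of k "2 ^ r" Y] mult_smult_distrib[of ?Y0 k k "1\<^sub>m k" k c]
        mult_smult_assoc_mat[of "1\<^sub>m k" k k ?Y0 k c] by simp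
  next
    assume H': "elem_abelian_2_subgroup (PGL k) H \<and> connectedin (pgl_top k) (centralizer (PGL k) H)"
    then have sub: "H \<subseteq> carrier (PGL k)" and inv: "\<And>x. x \<in> H \<Longrightarrow> x \<otimes>\<^bsub>PGL k\<^esub> x = \<one>\<^bsub>PGL k\<^esub>"
      by (auto simp: elem_abelian_2_subgroup_def dest: subgroup.subset)
    have Heq: "H = pcl ` {g \<in> GLn k. pcl g \<in> H}" using sub by (auto simp: carrier_PGL)
    have "pcl ?Y0 \<in> centralizer (PGL k) (pcl ` {g \<in> GLn k. pcl g \<in> H})"
    proof (subst pcl_in_centralizer_iff[OF Y0])
      show "{g \<in> GLn k. pcl g \<in> H} \<subseteq> carrier_mat k k" using GLn_carrier by blast
      show "\<forall>M\<in>{g \<in> GLn k. pcl g \<in> H}. \<exists>c. c \<noteq> 0 \<and> ?Y0 * M = c \<cdot>\<^sub>m (M * ?Y0)" using block by blast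
    qed
    then have "pcl ?Y0 \<in> centralizer (PGL k) H" using Heq by simp
    then show ?thesis
      using connected_centralizer_commute[OF two \<open>k > 0\<close> inv sub _ h Y0] H' by blast
  qed
  moreover obtain c where c: "Y * H_lift h = c \<cdot>\<^sub>m (H_lift h * Y)" "?Y0 * h = c \<cdot>\<^sub>m (h * ?Y0)" using block[OF h] by blast
  \<comment> \<open>The block relation holds both with scalar 1 and with \<open>c\<close>. As
    \<open>h * ?Y0\<close> is invertible, \<open>c = 1\<close>, and the relation for
    \<open>Y\<close> involves the same \<open>c\<close>.\<close>
  ultimately have "1 \<cdot>\<^sub>m (h * ?Y0) = c \<cdot>\<^sub>m (h * ?Y0)" by (simp add: one_smult_mat)
  then have "1 = c" by (rule GLn_smult_cancel[OF GLn_mult[OF h(1) Y0] \<open>k > 0\<close>])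
  then show ?thesis using c(1) by (simp add: one_smult_mat)
qed

text \<open>Splitting off an element of \<open>Bgrp k r\<close> leaves a matrix that commutes with
  every \<open>A_lift s\<close>, therefore with the lifts of \<open>H\<close> as well, so its class
  lies in the identity component.\<close>

lemma centralizer_factorization:
  assumes inf: "infinite (UNIV :: 'a set)" and two: "(2 :: 'a) \<noteq> 0" and "k > 0"
    and H: "H = {\<one>\<^bsub>PGL k\<^esub>} \<or>
         (elem_abelian_2_subgroup (PGL k) H \<and> connectedin (pgl_top k) (centralizer (PGL k) H))"
    and x: "x \<in> centralizer (PGL n) (pcl ` D_lifts)"
  shows "\<exists>y \<in> identity_component n (centralizer (PGL n) (pcl ` D_lifts)). \<exists>b\<in>Bgrp k r. x = y \<otimes>\<^bsub>PGL n\<^esub> b"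
proof -
  obtain X where X: "X \<in> GLn n" "x = pcl X" using x by (auto simp: centralizer_def carrier_PGL)
  have "n > 0" using \<open>k > 0\<close> n by simp
  then obtain Y b where Y: "Y \<in> GLn n" "pcl Y \<in> centralizer (PGL n) (pcl ` D_lifts)" and b: "b \<in> Bgrp k r"
    and eq: "pcl X = pcl Y \<otimes>\<^bsub>PGL n\<^esub> b" and comm: "\<And>s. s < r \<Longrightarrow> Y * A_lift s = A_lift s * Y"
    using adjust_by_Bgrp[OF _ order_refl X(1)] x X(2) by blast
  have "Y * M = M * Y" if "M \<in> D_lifts" for M
    using that comm commutes_with_tensor[OF two \<open>k > 0\<close> H Y comm] unfolding D_lifts_def by auto
  then show ?thesis using pcl_in_identity_component[OF inf Y(1)] b eq X(2) by blast
qed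

end

theorem theorem4p10:
  fixes K :: "'a::field itself"
    and n s t r k :: nat
    and H :: "'a mat set set"
  assumes "alg_closed_field K"
    and "(2::'a) \<noteq> 0"
    and "n = 2^s * t" and "odd t" and "s \<ge> 1" and "t \<ge> 1"
    and "1 \<le> r" and "r \<le> s" and "n = 2^r * k"
    and "H = {\<one>\<^bsub>PGL k\<^esub>} \<or>
         (elem_abelian_2_subgroup (PGL k) H \<and> toral k H \<and>
          connectedin (pgl_top k) (centralizer (PGL k) H))"
  shows "centralizer (PGL n) (Dgrp k r <#>\<^bsub>PGL n\<^esub> tensor_id k r H)
           = generate (PGL n) (identity_component n (centralizer (PGL n) (Dgrp k r <#>\<^bsub>PGL n\<^esub> tensor_id k r H))
                                \<union> (\<lambda>i. Bbar k r i) ` {0..<r})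
       \<and> centralizer (PGL n) (Dgrp k r <#>\<^bsub>PGL n\<^esub> tensor_id k r H)
           = identity_component n (centralizer (PGL n) (Dgrp k r <#>\<^bsub>PGL n\<^esub> tensor_id k r H))
               <#>\<^bsub>PGL n\<^esub> Bgrp k r"
proof -
  interpret group "PGL n" by (rule group_PGL)
  have n: "n = k * 2 ^ r" using assms(9) by simp
  have "n > 0" using assms(3,6) by simp
  then have k: "k > 0" using n by (cases k) auto
  \<comment> \<open>\<open>alg_closed_field\<close> ignores its argument, so unfolding it carries
    the hypothesis on \<open>K\<close> over to the type itself.\<close>
  have inf: "infinite (UNIV :: 'a set)"
    using assms(1) alg_closed_infinite by (simp add: alg_closed_field_def)
  have H1: "\<one>\<^bsub>PGL k\<^esub> \<in> H"
    using assms(10) by (auto simp: elem_abelian_2_subgroup_def dest: subgroup.one_closed)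
  have H: "H = {\<one>\<^bsub>PGL k\<^esub>} \<or>
         (elem_abelian_2_subgroup (PGL k) H \<and> connectedin (pgl_top k) (centralizer (PGL k) H))"
    using assms(10) by blast
  let ?M = "D_lifts k r H"
  define C where "C = centralizer (PGL n) (pcl ` ?M)"
  define I where "I = identity_component n C"
  have Ceq: "centralizer (PGL n) (Dgrp k r <#>\<^bsub>PGL n\<^esub> tensor_id k r H) = C"
    unfolding C_def by (rule centralizer_eq_D_lifts[OF n H1])
  have "pcl ` ?M \<subseteq> carrier (PGL n)" unfolding carrier_PGL using D_lifts_GLn[OF n] by blast
  then interpret C: subgroup C "PGL n" unfolding C_def by (rule subgroup_centralizer)
  have IC: "I \<subseteq> C"
    unfolding I_def identity_component_def
    using connected_component_of_subset_topspace[of "subtopology (pgl_top n) C"] by auto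
  have BC: "Bgrp k r \<subseteq> C" unfolding C_def by (rule Bgrp_subset_centralizer[OF n])
  have BbC: "Bbar k r ` {0..<r} \<subseteq> C" unfolding C_def using Bbar_in_centralizer[OF n] by auto
  \<comment> \<open>This supplies the nontrivial inclusion in both descriptions of \<open>C\<close>.
    The reverse inclusions hold because \<open>C\<close> is a subgroup containing \<open>I\<close>
    and every \<open>Bbar k r s\<close> with \<open>s < r\<close>.\<close>
  have fact: "\<exists>y\<in>I. \<exists>b\<in>Bgrp k r. x = y \<otimes>\<^bsub>PGL n\<^esub> b" if "x \<in> C" for x
    using centralizer_factorization[OF n inf assms(2) k H] that unfolding I_def C_def by blast
  have "C = I <#>\<^bsub>PGL n\<^esub> Bgrp k r"
  proof
    show "C \<subseteq> I <#>\<^bsub>PGL n\<^esub> Bgrp k r" using fact unfolding set_mult_def by blast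
    show "I <#>\<^bsub>PGL n\<^esub> Bgrp k r \<subseteq> C" using IC BC C.m_closed unfolding set_mult_def by blast
  qed
  moreover have "C = generate (PGL n) (I \<union> Bbar k r ` {0..<r})"
  proof
    show "generate (PGL n) (I \<union> Bbar k r ` {0..<r}) \<subseteq> C"
      using IC BbC by (intro generate_subgroup_incl C.subgroup_axioms) auto
    have Bgen: "Bgrp k r \<subseteq> generate (PGL n) (I \<union> Bbar k r ` {0..<r})"
      unfolding Bgrp_def assms(9)[symmetric] by (rule mono_generate) auto
    show "C \<subseteq> generate (PGL n) (I \<union> Bbar k r ` {0..<r})"
    proof (intro subsetI)
      fix x assume "x \<in> C"
      then obtain y b where "y \<in> I" "b \<in> Bgrp k r" "x = y \<otimes>\<^bsub>PGL n\<^esub> b" using fact by blast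
      then show "x \<in> generate (PGL n) (I \<union> Bbar k r ` {0..<r})"
        using Bgen by (auto intro: generate.eng generate.incl)
    qed
  qed
  ultimately show ?thesis unfolding Ceq I_def by simp
qed

end
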